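(* Let $n\ge 2$, let $m>2$ be an integer, and let $K_{1},\dots,K_{m}\subseteq\mathbb{R}^{n}$ be compact sets, each with connected boundary. Then $$\mathrm{vol}\left(\frac{\partial K_{1}+\dots+\partial K_{m}}{m}\right)\ge\mathrm{vol}(K_{1})^{\frac{1}{m}}\cdots\mathrm{vol}(K_{m})^{\frac{1}{m}}.$$ Moreover, when $K_1,\dots,K_m$ are convex bodies, equality holds if and only if $K_1,\dots,K_m$ are translations of one another.
   Context: $\mathrm{vol}$ denotes Lebesgue measure on $\mathbb{R}^n$; $\partial A$ is the topological boundary of $A$; sums of sets are Minkowski sums, $A+B=\{a+b: a\in A, b\in B\}$, and $\lambda A=\{\lambda a: a\in A\}$. A convex body is a compact convex set with non-empty interior. *)

theory Defs
  imports "HOL-Analysis.Analysis"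
begin

definition convex_body :: "'a::euclidean_space set \<Rightarrow> bool" where
  "convex_body A \<longleftrightarrow> compact A \<and> convex A \<and> interior A \<noteq> {}"

definition translate_of :: "'a::ab_group_add set \<Rightarrow> 'a set \<Rightarrow> bool" where
  "translate_of A B \<longleftrightarrow> (\<exists>v. A = (\<lambda>x. v + x) ` B)"

(* Addition of sets is the Minkowski sum of HOL-Library.Set_Algebras; for m = 0 the sum is {0}. *)
definition minkowski_mean :: "nat \<Rightarrow> (nat \<Rightarrow> 'a::euclidean_space set) \<Rightarrow> 'a set" where
  "minkowski_mean m A = (\<lambda>x. (1 / real m) *\<^sub>R x) ` (\<Sum>i<m. A i)"

end

theory Submission
  imports Defs "HOL-Probability.Distribution_Functions"
begin

text \<open>
  Let \<open>K\<^sub>1\<close> have the largest volume and put \<open>L = K\<^sub>2 + \<dots> + K\<^sub>m\<close>. Connectedness of the boundaries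
  shows that the sum of the boundaries contains \<open>K\<^sub>1 + L\<close> except for the set \<open>B\<close> of all \<open>x\<close> with
  \<open>x - L \<subseteq> K\<^sub>1\<close>. If \<open>B\<close> is empty, the Brunn-Minkowski inequality and the AM-GM inequality finish
  the proof. Otherwise, with volume radii \<open>r\<close> of \<open>K\<^sub>1\<close> and \<open>s\<close> of \<open>L\<close>, Brunn-Minkowski for
  \<open>B + (- L) \<subseteq> K\<^sub>1\<close> bounds the volume radius of \<open>B\<close> by \<open>r - s\<close>, and
  \<open>(r + s)^n - (r - s)^n \<ge> (2 sqrt (r s))^n\<close> exceeds the required bound strictly because \<open>m > 2\<close>.

  Equality therefore forces equal volumes and equality in Brunn-Minkowski for each pair \<open>K\<^sub>i + K\<^sub>j\<close>.
  Cutting both bodies of such a pair by parallel hyperplanes into pieces of volumes \<open>P\<close> and \<open>Q\<close>,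
  at heights \<open>a P\<close> and \<open>b Q\<close>, gives \<open>a R + b R \<le> a P + b Q\<close> for \<open>R = sqrt (P Q)\<close>. In logarithmic
  scale this inequality telescopes, so \<open>a - b\<close> is constant: in every direction the two marginals
  are translates of each other. Comparing first moments, the shift is linear in the direction, and
  separation by hyperplanes yields that the bodies are translates.
\<close>

subsection \<open>Volumes of pieces cut off by hyperplanes\<close>

text \<open>Up to a constant factor depending only on the dimension, the radius of a ball of the
  same volume. Brunn-Minkowski says that it is superadditive.\<close>

definition vrad :: "'a::euclidean_space set \<Rightarrow> real" where
  "vrad A = root DIM('a) (measure lebesgue A)"

lemma vrad_nonneg [simp]: "0 \<le> vrad A"
  by (simp add: vrad_def)

lemma vrad_pow: "vrad A ^ DIM('a) = measure lebesgue A" for A :: "'a::euclidean_space set"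
  by (simp add: vrad_def)

lemma vrad_pos_iff [simp]: "0 < vrad A \<longleftrightarrow> 0 < measure lebesgue A"
  by (simp add: vrad_def)

lemma compact_set_plus:
  fixes A B :: "'a::real_normed_vector set"
  assumes "compact A" "compact B"
  shows "compact (A + B)"
proof -
  have "A + B = {x + y | x y. x \<in> A \<and> y \<in> B}"
    by (auto simp: set_plus_def)
  then show ?thesis
    using compact_sums[OF assms] by simp
qed

lemma connected_set_plus:
  fixes A B :: "'a::real_normed_vector set"
  assumes "connected A" "connected B"
  shows "connected (A + B)"
  unfolding set_plus_image
  by (intro connected_continuous_image connected_Times assms)
     (auto simp: case_prod_unfold intro!: continuous_intros)

lemma measure_lebesgue_mono:
  assumes "A \<subseteq> B" "compact A" "compact B"
  shows "measure lebesgue A \<le> measure lebesgue B"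
  using assms by (intro measure_mono_fmeasurable) (auto intro: lmeasurable_compact fmeasurableD)

lemma compact_Int_halfspace_le: "compact A \<Longrightarrow> compact (A \<inter> {x. u \<bullet> x \<le> t})"
  and compact_Int_halfspace_ge: "compact A \<Longrightarrow> compact (A \<inter> {x. u \<bullet> x \<ge> t})"
  by (auto intro!: compact_Int_closed closed_halfspace_le closed_halfspace_ge)

lemma measure_Un_separated:
  assumes "compact A" "compact B" "u \<noteq> 0" "A \<subseteq> {x. u \<bullet> x \<le> t}" "B \<subseteq> {x. u \<bullet> x \<ge> t}"
  shows "measure lebesgue (A \<union> B) = measure lebesgue A + measure lebesgue B"
proof -
  have "A \<inter> B \<subseteq> {x. u \<bullet> x = t}"
    using assms(4,5) by fastforce
  then have "negligible (A \<inter> B)"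
    using negligible_hyperplane assms(3) negligible_subset by blast
  then show ?thesis
    using assms by (simp add: measure_Un3_negligible measure_Un3 lmeasurable_compact negligible_imp_measure0)
qed

lemma measure_cut:
  assumes "compact A" "u \<noteq> 0"
  shows "measure lebesgue A = measure lebesgue (A \<inter> {x. u \<bullet> x \<le> t}) + measure lebesgue (A \<inter> {x. u \<bullet> x \<ge> t})"
proof -
  have "A = (A \<inter> {x. u \<bullet> x \<le> t}) \<union> (A \<inter> {x. u \<bullet> x \<ge> t})"
    by auto
  then show ?thesis
    using measure_Un_separated[OF compact_Int_halfspace_le[OF assms(1)] compact_Int_halfspace_ge[OF assms(1)] assms(2)]
    by (metis inf_le2)
qed

text \<open>Encoded as a measure on the line so that facts on distribution functions apply: for
  compact \<open>A\<close>, its \<open>cdf\<close> at \<open>t\<close> is the volume of the part of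
  \<open>A\<close> below height \<open>t\<close>.\<close>

definition marginal :: "'a::euclidean_space set \<Rightarrow> 'a \<Rightarrow> real measure" where
  "marginal A u = distr (restrict_space lebesgue A) borel ((\<bullet>) u)"

lemma measurable_inner_restrict [measurable]:
  "(\<bullet>) u \<in> borel_measurable (restrict_space lebesgue A)"
  by (intro measurable_restrict_space1 measurable_completion) simp

lemma measure_marginal:
  assumes "compact A" "S \<in> sets borel"
  shows "measure (marginal A u) S = measure lebesgue (A \<inter> {x. u \<bullet> x \<in> S})"
proof -
  have "measure (marginal A u) S
      = measure (restrict_space lebesgue A) ((\<bullet>) u -` S \<inter> space (restrict_space lebesgue A))"
    using assms unfolding marginal_def by (intro measure_distr) auto
  also have "\<dots> = measure (restrict_space lebesgue A) (A \<inter> {x. u \<bullet> x \<in> S})"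
    by (simp add: space_restrict_space vimage_def Int_commute)
  also have "\<dots> = measure lebesgue (A \<inter> {x. u \<bullet> x \<in> S})"
    using assms by (intro measure_restrict_space) (auto simp: lmeasurable_compact fmeasurableD)
  finally show ?thesis .
qed

lemma finite_borel_measure_marginal:
  assumes "compact A"
  shows "finite_borel_measure (marginal A u)"
proof -
  interpret R: finite_measure "restrict_space lebesgue A"
    using lmeasurable_compact[OF assms]
    by (intro finite_measureI)
       (auto simp: fmeasurable_def emeasure_restrict_space space_restrict_space)
  interpret finite_measure "marginal A u"
    unfolding marginal_def by (intro R.finite_measure_distr) simp
  show ?thesis
    by unfold_locales (simp add: marginal_def)
qed

lemma cdf_marginal:
  assumes "compact A"
  shows "cdf (marginal A u) t = measure lebesgue (A \<inter> {x. u \<bullet> x \<le> t})"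
  using measure_marginal[OF assms, of "{..t}"] by (simp add: cdf_def)

text \<open>Hyperplanes are null sets, so the marginal has no atoms and its distribution function is
  continuous.\<close>

lemma continuous_cut:
  assumes "compact A" "u \<noteq> 0"
  shows "isCont (\<lambda>t. measure lebesgue (A \<inter> {x. u \<bullet> x \<le> t})) t"
proof -
  have "negligible (A \<inter> {x. u \<bullet> x \<in> {t}})"
    using negligible_hyperplane[of u t] assms(2) by (auto intro: negligible_subset)
  then have "measure (marginal A u) {t} = 0"
    using measure_marginal[OF assms(1), of "{t}"] by (simp add: negligible_imp_measure0)
  then show ?thesis
    using finite_borel_measure.isCont_cdf[OF finite_borel_measure_marginal[OF assms(1), of u], of t]
    by (simp add: cdf_marginal[OF assms(1), abs_def])
qed

lemma compact_halfspace_bounds: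
  assumes "compact A"
  obtains a b where "a \<le> b" "A \<inter> {x. u \<bullet> x \<le> a} = {}" "A \<subseteq> {x. u \<bullet> x \<le> b}"
proof -
  have "bounded ((\<bullet>) u ` A)"
    using assms by (intro compact_imp_bounded compact_continuous_image continuous_intros)
  then obtain c where c: "\<And>x. x \<in> A \<Longrightarrow> \<bar>u \<bullet> x\<bar> \<le> c"
    by (auto simp: bounded_iff)
  show ?thesis
  proof (rule that[of "- \<bar>c\<bar> - 1" "\<bar>c\<bar>"])
    show "A \<inter> {x. u \<bullet> x \<le> - \<bar>c\<bar> - 1} = {}"
      using c by fastforce
    show "A \<subseteq> {x. u \<bullet> x \<le> \<bar>c\<bar>}"
      using c by fastforce
  qed auto
qed

lemma exists_cut:
  assumes "compact A" "u \<noteq> 0" "0 \<le> p" "p \<le> measure lebesgue A"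
  obtains t where "measure lebesgue (A \<inter> {x. u \<bullet> x \<le> t}) = p"
proof -
  obtain a b where ab: "a \<le> b" "A \<inter> {x. u \<bullet> x \<le> a} = {}" "A \<subseteq> {x. u \<bullet> x \<le> b}"
    using compact_halfspace_bounds[OF assms(1)] .
  have "A \<inter> {x. u \<bullet> x \<le> b} = A"
    using ab by auto
  with ab have "\<exists>t. a \<le> t \<and> t \<le> b \<and> measure lebesgue (A \<inter> {x. u \<bullet> x \<le> t}) = p"
    using assms by (intro IVT) (auto intro!: continuous_cut)
  then show ?thesis
    using that by auto
qed

text \<open>The two partial sums lie on opposite sides of the hyperplane at height
  \<open>c + d\<close>, so their volumes add up inside the whole sum.\<close>

lemma measure_sum_separated:
  assumes "compact A1" "compact A2" "compact B1" "compact B2" "u \<noteq> 0"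
    and "A1 \<subseteq> {x. u \<bullet> x \<le> c}" "A2 \<subseteq> {x. u \<bullet> x \<ge> c}"
    and "B1 \<subseteq> {x. u \<bullet> x \<le> d}" "B2 \<subseteq> {x. u \<bullet> x \<ge> d}"
  shows "measure lebesgue (A1 + B1) + measure lebesgue (A2 + B2) \<le> measure lebesgue ((A1 \<union> A2) + (B1 \<union> B2))"
proof -
  have *: "A1 + B1 \<subseteq> {x. u \<bullet> x \<le> c + d}" "A2 + B2 \<subseteq> {x. u \<bullet> x \<ge> c + d}"
    using assms(6-9) by (force simp: set_plus_def inner_add_right intro: add_mono)+
  have "measure lebesgue (A1 + B1) + measure lebesgue (A2 + B2) = measure lebesgue ((A1 + B1) \<union> (A2 + B2))"
    using measure_Un_separated[OF _ _ assms(5) *] assms by (simp add: compact_set_plus)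
  also have "\<dots> \<le> measure lebesgue ((A1 \<union> A2) + (B1 \<union> B2))"
    using assms by (intro measure_lebesgue_mono compact_set_plus compact_Un) (auto simp: set_plus_def)
  finally show ?thesis .
qed

lemma measure_sum_ge_left:
  fixes A B :: "'a::euclidean_space set"
  assumes "compact A" "compact B" "B \<noteq> {}"
  shows "measure lebesgue A \<le> measure lebesgue (A + B)"
proof -
  obtain b where "b \<in> B"
    using assms by auto
  then have "(+) b ` A \<subseteq> A + B"
    by (auto simp: set_plus_def) (metis add.commute)
  then show ?thesis
    using assms measure_lebesgue_mono[of "(+) b ` A" "A + B"]
    by (simp add: measure_translation compact_set_plus compact_translation)
qed

subsection \<open>The Brunn-Minkowski inequality\<close>

text \<open>Positive volumes are assumed because an empty summand makes the sum empty.\<close>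

definition brunn_minkowski_pair :: "'a::euclidean_space set \<Rightarrow> 'a set \<Rightarrow> bool" where
  "brunn_minkowski_pair A B \<longleftrightarrow> (0 < measure lebesgue A \<longrightarrow> 0 < measure lebesgue B \<longrightarrow>
     (vrad A + vrad B) ^ DIM('a) \<le> measure lebesgue (A + B))"

lemma brunn_minkowski_pair_sym: "brunn_minkowski_pair A B \<longleftrightarrow> brunn_minkowski_pair B A"
  by (auto simp: brunn_minkowski_pair_def add.commute)

text \<open>The cutting step of Hadwiger and Ohmann: \<open>B\<close> is cut in the same volume ratio as \<open>A1 \<union> A2\<close>, so that
  the inequality for the two pairs of pieces adds up to the inequality for the whole.\<close>

lemma brunn_minkowski_pair_Un:
  fixes A1 A2 B :: "'a::euclidean_space set"
  assumes "compact A1" "compact A2" "compact B" "u \<noteq> 0"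
    and "A1 \<subseteq> {x. u \<bullet> x \<le> c}" "A2 \<subseteq> {x. u \<bullet> x \<ge> c}"
    and bm1: "\<And>d. brunn_minkowski_pair A1 (B \<inter> {x. u \<bullet> x \<le> d})"
    and bm2: "\<And>d. brunn_minkowski_pair A2 (B \<inter> {x. u \<bullet> x \<ge> d})"
  shows "brunn_minkowski_pair (A1 \<union> A2) B"
  unfolding brunn_minkowski_pair_def
proof (intro impI)
  let ?v = "measure lebesgue" and ?n = "DIM('a)"
  define A where "A = A1 \<union> A2"
  assume pos: "0 < ?v (A1 \<union> A2)" "0 < ?v B"
  have vA: "?v A = ?v A1 + ?v A2"
    unfolding A_def using assms by (intro measure_Un_separated)
  define p where "p = ?v A1 / ?v A"
  have vA1: "?v A1 = p * ?v A" and vA2: "?v A2 = (1 - p) * ?v A" and p: "0 \<le> p" "p \<le> 1"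
    using pos vA by (auto simp: p_def A_def field_simps)
  obtain d where d: "?v (B \<inter> {x. u \<bullet> x \<le> d}) = p * ?v B"
    using exists_cut[of B u "p * ?v B"] assms p pos by (auto simp: mult_left_le_one_le)
  define B1 B2 where "B1 = B \<inter> {x. u \<bullet> x \<le> d}" and "B2 = B \<inter> {x. u \<bullet> x \<ge> d}"
  have vB1: "?v B1 = p * ?v B" and vB2: "?v B2 = (1 - p) * ?v B"
    using d measure_cut[OF \<open>compact B\<close> \<open>u \<noteq> 0\<close>, of d] by (auto simp: B1_def B2_def algebra_simps)
  have cB: "compact B1" "compact B2"
    using \<open>compact B\<close> by (auto simp: B1_def B2_def compact_Int_halfspace_le compact_Int_halfspace_ge)
  \<comment> \<open>Pieces carrying the same fraction \<open>q\<close> of both volumes have their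
    volume radii scaled by the same factor \<open>root ?n q\<close>, so the bound scales by
    \<open>q\<close>. Null pieces form a separate case because \<open>brunn_minkowski_pair\<close>
    asserts nothing about them.\<close>
  have scaled: "q * (vrad A + vrad B) ^ ?n \<le> ?v (X + Y)"
    if "brunn_minkowski_pair X Y" "?v X = q * ?v A" "?v Y = q * ?v B" "0 \<le> q" for X Y :: "'a set" and q
  proof (cases "q = 0")
    case False
    then have "(vrad X + vrad Y) ^ ?n \<le> ?v (X + Y)"
      using that pos by (auto simp: brunn_minkowski_pair_def A_def)
    moreover have "vrad X + vrad Y = root ?n q * (vrad A + vrad B)"
      using that by (simp add: vrad_def real_root_mult algebra_simps)
    ultimately show ?thesis
      using \<open>0 \<le> q\<close> by (simp add: power_mult_distrib)
  qed simp
  have "p * (vrad A + vrad B) ^ ?n \<le> ?v (A1 + B1)"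
    using p by (intro scaled vA1 vB1 bm1[of d, folded B1_def])
  moreover have "(1 - p) * (vrad A + vrad B) ^ ?n \<le> ?v (A2 + B2)"
    using p by (intro scaled vA2 vB2 bm2[of d, folded B2_def]) auto
  ultimately have "(vrad A + vrad B) ^ ?n \<le> ?v (A1 + B1) + ?v (A2 + B2)"
    by (simp add: algebra_simps)
  also have "\<dots> \<le> ?v ((A1 \<union> A2) + (B1 \<union> B2))"
    using assms cB by (intro measure_sum_separated[where u=u and c=c and d=d]) (auto simp: B1_def B2_def)
  also have "B1 \<union> B2 = B"
    by (auto simp: B1_def B2_def)
  finally show "(vrad (A1 \<union> A2) + vrad B) ^ ?n \<le> ?v (A1 \<union> A2 + B)"
    by (simp add: A_def)
qed

section \<open>Boxes and finite unions of boxes\<close>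

lemma root_prod_le_mean:
  fixes x :: "'a \<Rightarrow> real"
  assumes "finite S" "S \<noteq> {}" "\<And>i. i \<in> S \<Longrightarrow> x i > 0"
  shows "root (card S) (\<Prod>i\<in>S. x i) \<le> (\<Sum>i\<in>S. x i) / card S"
proof -
  have "root (card S) (\<Prod>i\<in>S. x i) = (\<Prod>i\<in>S. x i) powr (1 / card S)"
    using assms by (simp add: root_powr_inverse card_gt_0_iff prod_nonneg less_imp_le)
  also have "\<dots> \<le> (\<Sum>i\<in>S. x i) / card S"
    using arith_geom_mean[of S x] assms by (simp add: sum_divide_distrib less_imp_le)
  finally show ?thesis .
qed

text \<open>Brunn-Minkowski for boxes with side lengths \<open>a i\<close> and \<open>b i\<close>.
  After division by the root of the right-hand side, AM-GM applies to the ratios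
  \<open>a i / (a i + b i)\<close> and \<open>b i / (a i + b i)\<close>, whose arithmetic means add
  up to 1.\<close>

lemma root_prod_add_le:
  fixes a b :: "'a \<Rightarrow> real"
  assumes "finite S" "S \<noteq> {}" and pos: "\<And>i. i \<in> S \<Longrightarrow> a i > 0" "\<And>i. i \<in> S \<Longrightarrow> b i > 0"
  shows "(root (card S) (\<Prod>i\<in>S. a i) + root (card S) (\<Prod>i\<in>S. b i)) ^ card S \<le> (\<Prod>i\<in>S. a i + b i)"
proof -
  let ?n = "card S"
  have n: "?n > 0"
    using assms by (simp add: card_gt_0_iff)
  define P where "P = root ?n (\<Prod>i\<in>S. a i + b i)"
  have ab: "a i + b i > 0" if "i \<in> S" for i
    using pos[OF that] by simp
  then have P: "P > 0"
    unfolding P_def using n by (simp add: prod_pos)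
  have "root ?n (\<Prod>i\<in>S. a i / (a i + b i)) + root ?n (\<Prod>i\<in>S. b i / (a i + b i))
    \<le> (\<Sum>i\<in>S. a i / (a i + b i)) / ?n + (\<Sum>i\<in>S. b i / (a i + b i)) / ?n"
    using assms ab by (intro add_mono root_prod_le_mean) auto
  also have "\<dots> = (\<Sum>i\<in>S. (a i + b i) / (a i + b i)) / ?n"
    unfolding add_divide_distrib sum.distrib ..
  also have "(\<Sum>i\<in>S. (a i + b i) / (a i + b i)) = (\<Sum>i\<in>S. 1)"
    using ab by (intro sum.cong) (auto simp: less_imp_neq[symmetric])
  also have "\<dots> / ?n = 1"
    using n by simp
  finally have "root ?n (\<Prod>i\<in>S. a i) / P + root ?n (\<Prod>i\<in>S. b i) / P \<le> 1"
    by (simp add: P_def prod_dividef real_root_divide)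
  then have "root ?n (\<Prod>i\<in>S. a i) + root ?n (\<Prod>i\<in>S. b i) \<le> P"
    using P by (simp add: field_simps)
  moreover have "0 \<le> root ?n (\<Prod>i\<in>S. a i) + root ?n (\<Prod>i\<in>S. b i)"
    by (intro add_nonneg_nonneg real_root_ge_zero prod_nonneg) (auto intro: less_imp_le pos)
  ultimately have "(root ?n (\<Prod>i\<in>S. a i) + root ?n (\<Prod>i\<in>S. b i)) ^ ?n \<le> P ^ ?n"
    by (intro power_mono)
  also have "P ^ ?n = (\<Prod>i\<in>S. a i + b i)"
    unfolding P_def using n ab by (intro real_root_pow_pos2 prod_nonneg) (auto intro: less_imp_le)
  finally show ?thesis .
qed

lemma brunn_minkowski_pair_cbox: "brunn_minkowski_pair (cbox a b) (cbox c d)" for a b c d :: "'a::euclidean_space"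
  unfolding brunn_minkowski_pair_def
proof (intro impI)
  assume pos: "0 < measure lebesgue (cbox a b)" "0 < measure lebesgue (cbox c d)"
  then have side: "\<And>i. i \<in> Basis \<Longrightarrow> a \<bullet> i < b \<bullet> i" "\<And>i. i \<in> Basis \<Longrightarrow> c \<bullet> i < d \<bullet> i"
    using content_pos_lt_eq by auto
  have sum_side: "\<And>i. i \<in> Basis \<Longrightarrow> (a + c) \<bullet> i < (b + d) \<bullet> i"
    using side by (simp add: inner_add_left add_strict_mono)
  have "cbox (a + c) (b + d) \<subseteq> cbox a b + cbox c d"
  proof
    fix x assume x: "x \<in> cbox (a + c) (b + d)"
    \<comment> \<open>The coordinatewise least point above \<open>a\<close> for which
      \<open>x - y\<close> stays below \<open>d\<close>.\<close>
    define y where "y = (\<Sum>i\<in>Basis. max (a \<bullet> i) (x \<bullet> i - d \<bullet> i) *\<^sub>R i)"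
    have yi: "y \<bullet> i = max (a \<bullet> i) (x \<bullet> i - d \<bullet> i)" if "i \<in> Basis" for i
      using that by (simp add: y_def)
    have "y \<in> cbox a b" "x - y \<in> cbox c d"
      using x side by (auto simp: mem_box yi inner_diff_left inner_add_left max_def less_imp_le)
    then show "x \<in> cbox a b + cbox c d"
      using set_plus_intro by fastforce
  qed
  then have "measure lebesgue (cbox (a + c) (b + d)) \<le> measure lebesgue (cbox a b + cbox c d)"
    by (intro measure_lebesgue_mono compact_set_plus compact_cbox)
  moreover have "measure lebesgue (cbox (a + c) (b + d)) = (\<Prod>i\<in>Basis. (b \<bullet> i - a \<bullet> i) + (d \<bullet> i - c \<bullet> i))"
    using sum_side by (simp add: less_imp_le inner_add_left algebra_simps)
  moreover have "measure lebesgue (cbox p q) = (\<Prod>i\<in>Basis. q \<bullet> i - p \<bullet> i)"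
    if "\<And>i. i \<in> Basis \<Longrightarrow> p \<bullet> i < q \<bullet> i" for p q :: 'a
    using that by (simp add: less_imp_le) (simp add: inner_diff_left[abs_def])
  with side have "(vrad (cbox a b) + vrad (cbox c d)) ^ DIM('a)
      \<le> (\<Prod>i\<in>Basis. (b \<bullet> i - a \<bullet> i) + (d \<bullet> i - c \<bullet> i))"
    unfolding vrad_def
    using side root_prod_add_le[of "Basis :: 'a set" "\<lambda>i. b \<bullet> i - a \<bullet> i" "\<lambda>i. d \<bullet> i - c \<bullet> i"]
    by simp
  ultimately show "(vrad (cbox a b) + vrad (cbox c d)) ^ DIM('a) \<le> measure lebesgue (cbox a b + cbox c d)"
    by simp
qed

text \<open>Finite unions of boxes assembled so that every union comes with a separating hyperplane
  normal to a basis vector. This hyperplane is what \<open>brunn_minkowski_pair_Un\<close> requires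
  in the inductions below.\<close>

inductive guillotine :: "'a::euclidean_space set \<Rightarrow> bool" where
  cbox: "guillotine (cbox a b)"
| Un: "guillotine A \<Longrightarrow> guillotine B \<Longrightarrow> i \<in> Basis \<Longrightarrow> A \<subseteq> {x. i \<bullet> x \<le> c} \<Longrightarrow> B \<subseteq> {x. i \<bullet> x \<ge> c}
    \<Longrightarrow> guillotine (A \<union> B)"

lemma guillotine_compact: "guillotine A \<Longrightarrow> compact A"
  by (induction rule: guillotine.induct) auto

lemma cbox_Int_halfspace:
  assumes "i \<in> Basis"
  shows "\<exists>c d. cbox a b \<inter> {x. i \<bullet> x \<le> t} = cbox c d" "\<exists>c d. cbox a b \<inter> {x. i \<bullet> x \<ge> t} = cbox c d"
  using interval_split[OF assms, of a b t] by (auto simp: inner_commute)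

lemma guillotine_Int_halfspace:
  assumes "guillotine A" "j \<in> Basis"
  shows "guillotine (A \<inter> {x. j \<bullet> x \<le> t}) \<and> guillotine (A \<inter> {x. j \<bullet> x \<ge> t})"
  using assms(1)
proof induction
  case (cbox a b)
  then show ?case
    using cbox_Int_halfspace[OF assms(2), of a b t] by (auto intro: guillotine.cbox)
next
  case (Un A B i c)
  then show ?case
    unfolding Int_Un_distrib2 by (intro conjI guillotine.Un[of _ _ i c]) auto
qed

text \<open>Induction over the cuts of \<open>B\<close>. The opposite box is cut by hyperplanes
  normal to basis vectors, so its pieces are boxes again.\<close>

lemma brunn_minkowski_pair_cbox_guillotine:
  assumes "guillotine B"
  shows "brunn_minkowski_pair (cbox a b) B"
  using assms
proof (induction arbitrary: a b)
  case (cbox c d)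
  then show ?case
    by (rule brunn_minkowski_pair_cbox)
next
  case (Un A B i c)
  have "brunn_minkowski_pair (A \<union> B) (cbox a b)"
  proof (rule brunn_minkowski_pair_Un[where u=i and c=c])
    fix d
    show "brunn_minkowski_pair A (cbox a b \<inter> {x. i \<bullet> x \<le> d})" "brunn_minkowski_pair B (cbox a b \<inter> {x. i \<bullet> x \<ge> d})"
      using Un cbox_Int_halfspace[OF \<open>i \<in> Basis\<close>, of a b d] by (metis brunn_minkowski_pair_sym)+
  qed (use Un guillotine_compact in auto)
  then show ?case
    by (simp add: brunn_minkowski_pair_sym)
qed

text \<open>Induction over the cuts of \<open>A\<close> for arbitrary \<open>B\<close>: the pieces
  of \<open>B\<close> on either side of a coordinate hyperplane are guillotine sets, so the
  induction hypothesis covers them.\<close>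

lemma brunn_minkowski_pair_guillotine:
  assumes "guillotine A" "guillotine B"
  shows "brunn_minkowski_pair A B"
  using assms
proof (induction arbitrary: B)
  case (cbox a b)
  then show ?case
    by (simp add: brunn_minkowski_pair_cbox_guillotine)
next
  case (Un A1 A2 i c)
  show ?case
  proof (rule brunn_minkowski_pair_Un[where u=i and c=c])
    fix d
    show "brunn_minkowski_pair A1 (B \<inter> {x. i \<bullet> x \<le> d})" "brunn_minkowski_pair A2 (B \<inter> {x. i \<bullet> x \<ge> d})"
      using Un.IH guillotine_Int_halfspace[OF Un.prems Un.hyps(3), of d] by auto
  qed (use Un guillotine_compact in auto)
qed

section \<open>Outer approximation of compact sets by guillotine sets\<close>

definition guillotine_approx :: "real \<Rightarrow> 'a::euclidean_space set \<Rightarrow> 'a set \<Rightarrow> bool" where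
  "guillotine_approx e A X \<longleftrightarrow> (\<exists>G. guillotine G \<and> A \<inter> X \<subseteq> G \<and> G \<subseteq> X \<and> G \<subseteq> (\<Union>x\<in>A. cball x e))"

text \<open>Confining the approximating set to the region \<open>X\<close> keeps the two halves on
  their own sides of the cut, so their union is again a guillotine set.\<close>

lemma guillotine_approx_split:
  assumes "guillotine_approx e A (X \<inter> {x. i \<bullet> x \<le> c})" "guillotine_approx e A (X \<inter> {x. i \<bullet> x \<ge> c})"
    and "i \<in> Basis"
  shows "guillotine_approx e A X"
proof -
  obtain G H where G: "guillotine G" "A \<inter> (X \<inter> {x. i \<bullet> x \<le> c}) \<subseteq> G" "G \<subseteq> X \<inter> {x. i \<bullet> x \<le> c}"
      "G \<subseteq> (\<Union>x\<in>A. cball x e)"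
    and H: "guillotine H" "A \<inter> (X \<inter> {x. i \<bullet> x \<ge> c}) \<subseteq> H" "H \<subseteq> X \<inter> {x. i \<bullet> x \<ge> c}"
      "H \<subseteq> (\<Union>x\<in>A. cball x e)"
    using assms unfolding guillotine_approx_def by auto
  have "A \<inter> X \<subseteq> G \<union> H"
  proof
    fix x assume "x \<in> A \<inter> X"
    then show "x \<in> G \<union> H"
      using G(2) H(2) by (cases "i \<bullet> x \<le> c") auto
  qed
  moreover have "guillotine (G \<union> H)"
    using G H assms(3) by (intro guillotine.Un[of _ _ i c]) auto
  ultimately show ?thesis
    unfolding guillotine_approx_def using G H by (intro exI[of _ "G \<union> H"]) auto
qed

lemma guillotine_approx_small:
  fixes a b :: "'a::euclidean_space" and \<delta> e :: real
  assumes "\<And>i. i \<in> Basis \<Longrightarrow> b \<bullet> i - a \<bullet> i \<le> \<delta>" "DIM('a) * \<delta> \<le> e"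
  shows "guillotine_approx e A (cbox a b)"
proof (cases "A \<inter> cbox a b = {}")
  case True
  \<comment> \<open>A box with reversed corners represents the empty set as a guillotine
    set.\<close>
  moreover have "cbox One (0::'a) = {}"
    by (auto simp: box_eq_empty SOME_Basis intro!: exI[of _ "SOME i. i \<in> Basis"])
  ultimately show ?thesis
    unfolding guillotine_approx_def using guillotine.cbox[of One "0::'a"]
    by (intro exI[of _ "{}"]) auto
next
  case False
  then obtain y where y: "y \<in> A" "y \<in> cbox a b"
    by auto
  have "cbox a b \<subseteq> cball y e"
  proof
    fix x assume x: "x \<in> cbox a b"
    have "norm (x - y) \<le> (\<Sum>i\<in>Basis. \<bar>(x - y) \<bullet> i\<bar>)"
      by (rule norm_le_l1)
    also have "\<dots> \<le> (\<Sum>i\<in>(Basis::'a set). \<delta>)"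
      using x y(2) assms(1) by (intro sum_mono) (fastforce simp: mem_box inner_diff_left abs_le_iff)
    also have "\<dots> \<le> e"
      using assms(2) by simp
    finally show "x \<in> cball y e"
      by (simp add: dist_norm norm_minus_commute)
  qed
  then show ?thesis
    unfolding guillotine_approx_def using y guillotine.cbox[of a b] by (intro exI[of _ "cbox a b"]) auto
qed

text \<open>The box is sliced until all sides are at most \<open>\<delta>\<close>, which makes the
  pieces small enough in the l1 norm. The set \<open>I\<close> collects the coordinates in which the
  box may still be long, and the inner induction counts the slices of width \<open>\<delta>\<close>
  in direction \<open>j\<close>.\<close>

lemma guillotine_approx_cbox:
  fixes a b :: "'a::euclidean_space"
  assumes "0 < e"
  shows "guillotine_approx e A (cbox a b)"
proof -
  define \<delta> where "\<delta> = e / DIM('a)"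
  have \<delta>: "\<delta> > 0" "DIM('a) * \<delta> \<le> e"
    using assms by (auto simp: \<delta>_def)
  have "guillotine_approx e A (cbox a b)"
    if "finite I" "I \<subseteq> Basis" "\<And>i. i \<in> Basis - I \<Longrightarrow> b \<bullet> i - a \<bullet> i \<le> \<delta>" for I and a b :: 'a
    using that
  proof (induction I arbitrary: a b rule: finite_induct)
    case empty
    then show ?case
      by (intro guillotine_approx_small[OF _ \<delta>(2)]) auto
  next
    case (insert j I)
    obtain N :: nat where "b \<bullet> j - a \<bullet> j \<le> N * \<delta>"
      using \<delta>(1) reals_Archimedean3 less_imp_le by blast
    then show ?case
      using insert.prems
    proof (induction N arbitrary: a b)
      case 0
      then show ?case
        using \<delta>(1) by (intro insert.IH) force+
    next
      case (Suc N)
      have j: "j \<in> Basis"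
        using Suc.prems by auto
      define c where "c = a \<bullet> j + \<delta>"
      define b' where "b' = (\<Sum>i\<in>Basis. (if i = j then min (b \<bullet> j) c else b \<bullet> i) *\<^sub>R i)"
      define a' where "a' = (\<Sum>i\<in>Basis. (if i = j then max (a \<bullet> j) c else a \<bullet> i) *\<^sub>R i)"
      have b': "b' \<bullet> i = (if i = j then min (b \<bullet> j) c else b \<bullet> i)"
        and a': "a' \<bullet> i = (if i = j then max (a \<bullet> j) c else a \<bullet> i)" if "i \<in> Basis" for i
        using that by (simp_all add: a'_def b'_def)
      have "cbox a b \<inter> {x. j \<bullet> x \<le> c} = cbox a b'" "cbox a b \<inter> {x. j \<bullet> x \<ge> c} = cbox a' b"
        using interval_split[OF j, of a b c] by (simp_all add: a'_def b'_def inner_commute)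
      moreover have "guillotine_approx e A (cbox a b')"
        using Suc.prems \<delta> by (intro insert.IH) (auto simp: b' c_def min_def)
      moreover have "guillotine_approx e A (cbox a' b)"
        using Suc.prems \<delta> j by (intro Suc.IH) (auto simp: a' c_def algebra_simps)
      ultimately show ?case
        using guillotine_approx_split[OF _ _ j] by metis
    qed
  qed
  from this[of Basis b a] show ?thesis
    by auto
qed

lemma compact_guillotine_approx:
  fixes A :: "'a::euclidean_space set"
  assumes "compact A" "0 < e"
  obtains G where "guillotine G" "A \<subseteq> G" "G \<subseteq> (\<Union>x\<in>A. cball x e)"
proof -
  obtain a where "A \<subseteq> cbox (-a) a"
    using assms bounded_subset_cbox_symmetric compact_imp_bounded by blast
  moreover have "guillotine_approx e A (cbox (-a) a)"
    using assms by (intro guillotine_approx_cbox)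
  ultimately show ?thesis
    unfolding guillotine_approx_def using that by blast
qed

text \<open>Outer regularity gives an open superset of slightly larger volume, and by compactness it
  contains a closed neighbourhood of \<open>C\<close>.\<close>

lemma measure_compact_outer_cball:
  fixes C :: "'a::euclidean_space set"
  assumes "compact C" "0 < e"
  obtains \<delta> where "0 < \<delta>"
    "\<And>D. D \<in> sets lebesgue \<Longrightarrow> D \<subseteq> (\<Union>x\<in>C. cball x \<delta>) \<Longrightarrow> measure lebesgue D \<le> measure lebesgue C + e"
proof -
  obtain U where U: "open U" "C \<subseteq> U" "U - C \<in> lmeasurable" "emeasure lebesgue (U - C) < ennreal e"
    using sets_lebesgue_outer_open[of C e] assms lmeasurable_compact by blast
  have C: "C \<in> lmeasurable"
    using assms by (simp add: lmeasurable_compact)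
  have UC: "measure lebesgue (U - C) < e"
    using U(3,4) assms(2) by (simp add: emeasure_eq_measure2 ennreal_less_iff)
  have Ueq: "U = C \<union> (U - C)"
    using U by auto
  have Um: "U \<in> lmeasurable"
    using Ueq C U(3) by (metis fmeasurable.Un)
  have "measure lebesgue U \<le> measure lebesgue C + measure lebesgue (U - C)"
    using Ueq C U(3) by (metis fmeasurableD measure_Un_le)
  with UC have Ue: "measure lebesgue U \<le> measure lebesgue C + e"
    by simp
  obtain \<delta> where "\<delta> > 0" and \<delta>: "(\<Union>x\<in>C. cball x \<delta>) \<subseteq> U"
    using compact_subset_open_imp_cball_epsilon_subset[OF assms(1) U(1,2)] .
  show ?thesis
  proof (rule that[OF \<open>\<delta> > 0\<close>])
    fix D assume "D \<in> sets lebesgue" "D \<subseteq> (\<Union>x\<in>C. cball x \<delta>)"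
    then have "measure lebesgue D \<le> measure lebesgue U"
      using \<delta> Um by (intro measure_mono_fmeasurable) auto
    then show "measure lebesgue D \<le> measure lebesgue C + e"
      using Ue by simp
  qed
qed

lemma vrad_mono: "measure lebesgue A \<le> measure lebesgue B \<Longrightarrow> vrad A \<le> vrad B"
  for A B :: "'a::euclidean_space set"
  by (simp add: vrad_def)

text \<open>Guillotine sets within \<open>\<delta> / 2\<close> of \<open>A\<close> and
  \<open>B\<close> have their sum within \<open>\<delta>\<close> of \<open>A + B\<close>, so its
  volume exceeds that of \<open>A + B\<close> by at most \<open>e\<close>. If one set is null, it
  suffices that \<open>A + B\<close> contains a translate of the other.\<close>

lemma brunn_minkowski_compact:
  fixes A B :: "'a::euclidean_space set"
  assumes A: "compact A" "A \<noteq> {}" and B: "compact B" "B \<noteq> {}"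
  shows "vrad A + vrad B \<le> vrad (A + B)"
proof -
  let ?v = "measure lebesgue" and ?n = "DIM('a)"
  have bound: "(vrad A + vrad B) ^ ?n \<le> ?v (A + B)"
  proof -
    consider "?v A = 0" | "?v B = 0" | "0 < ?v A" "0 < ?v B"
      using zero_less_measure_iff by blast
    then show ?thesis
    proof cases
      case 1
      then have "vrad A = 0" by (simp add: vrad_def)
      then show ?thesis
        using measure_sum_ge_left[OF B(1) A] by (simp add: vrad_pow add.commute)
    next
      case 2
      then have "vrad B = 0" by (simp add: vrad_def)
      then show ?thesis
        using measure_sum_ge_left[OF A(1) B] by (simp add: vrad_pow)
    next
      case 3
      show ?thesis
      proof (rule field_le_epsilon)
        fix e :: real assume "0 < e"
        then obtain \<delta> where \<delta>: "0 < \<delta>"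
          "\<And>D. D \<in> sets lebesgue \<Longrightarrow> D \<subseteq> (\<Union>x\<in>A + B. cball x \<delta>) \<Longrightarrow> ?v D \<le> ?v (A + B) + e"
          using measure_compact_outer_cball[OF compact_set_plus[OF A(1) B(1)]] by blast
        obtain G where G: "guillotine G" "A \<subseteq> G" "G \<subseteq> (\<Union>x\<in>A. cball x (\<delta> / 2))"
          using compact_guillotine_approx[OF A(1), of "\<delta> / 2"] \<delta>(1) by auto
        obtain H where H: "guillotine H" "B \<subseteq> H" "H \<subseteq> (\<Union>x\<in>B. cball x (\<delta> / 2))"
          using compact_guillotine_approx[OF B(1), of "\<delta> / 2"] \<delta>(1) by auto
        have le: "?v A \<le> ?v G" "?v B \<le> ?v H"
          using G H A B guillotine_compact by (auto intro!: measure_lebesgue_mono)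
        have "G + H \<subseteq> (\<Union>x\<in>A + B. cball x \<delta>)"
        proof
          fix z assume "z \<in> G + H"
          then obtain g h where gh: "z = g + h" "g \<in> G" "h \<in> H"
            by (rule set_plus_elim)
          then obtain x y where "x \<in> A" "dist x g \<le> \<delta> / 2" "y \<in> B" "dist y h \<le> \<delta> / 2"
            using G(3) H(3) by fastforce
          moreover have "dist (x + y) (g + h) \<le> dist x g + dist y h"
            by (rule dist_triangle_add)
          ultimately show "z \<in> (\<Union>x\<in>A + B. cball x \<delta>)"
            using gh by (intro UN_I[of "x + y"]) auto
        qed
        then have "?v (G + H) \<le> ?v (A + B) + e"
          using G H guillotine_compact
          by (intro \<delta>(2)) (auto intro!: fmeasurableD lmeasurable_compact compact_set_plus)
        moreover have "(vrad G + vrad H) ^ ?n \<le> ?v (G + H)"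
          using brunn_minkowski_pair_guillotine[OF G(1) H(1)] 3 le by (auto simp: brunn_minkowski_pair_def)
        moreover have "(vrad A + vrad B) ^ ?n \<le> (vrad G + vrad H) ^ ?n"
          using le by (intro power_mono add_mono vrad_mono add_nonneg_nonneg vrad_nonneg)
        ultimately show "(vrad A + vrad B) ^ ?n \<le> ?v (A + B) + e"
          by linarith
      qed
    qed
  qed
  then have "root ?n ((vrad A + vrad B) ^ ?n) \<le> vrad (A + B)"
    by (simp add: vrad_def[of "A + B"])
  then show ?thesis
    by (simp add: real_root_power_cancel)
qed

section \<open>Sums of finitely many sets\<close>

lemma compact_sum_sets:
  fixes K :: "'i \<Rightarrow> 'a::real_normed_vector set"
  assumes "\<And>i. i \<in> I \<Longrightarrow> compact (K i)"
  shows "compact (\<Sum>i\<in>I. K i)"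
  using assms by (induction I rule: infinite_finite_induct) (auto simp: compact_set_plus)

lemma connected_sum_sets:
  fixes K :: "'i \<Rightarrow> 'a::real_normed_vector set"
  assumes "\<And>i. i \<in> I \<Longrightarrow> connected (K i)"
  shows "connected (\<Sum>i\<in>I. K i)"
  using assms by (induction I rule: infinite_finite_induct) (auto simp: connected_set_plus)

lemma set_plus_nonempty [simp]: "A + B \<noteq> {} \<longleftrightarrow> A \<noteq> {} \<and> B \<noteq> {}" for A B :: "'a::plus set"
  by (auto simp: set_plus_def)

lemma sum_sets_nonempty:
  fixes K :: "'i \<Rightarrow> 'a::comm_monoid_add set"
  assumes "\<And>i. i \<in> I \<Longrightarrow> K i \<noteq> {}"
  shows "(\<Sum>i\<in>I. K i) \<noteq> {}"
  using assms by (induction I rule: infinite_finite_induct) auto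

lemma brunn_minkowski_sum:
  fixes K :: "'i \<Rightarrow> 'a::euclidean_space set"
  assumes "finite I" "\<And>i. i \<in> I \<Longrightarrow> compact (K i)" "\<And>i. i \<in> I \<Longrightarrow> K i \<noteq> {}"
  shows "(\<Sum>i\<in>I. vrad (K i)) \<le> vrad (\<Sum>i\<in>I. K i)"
  using assms
proof (induction I rule: finite_induct)
  case (insert j I)
  then have "vrad (K j) + vrad (\<Sum>i\<in>I. K i) \<le> vrad (K j + (\<Sum>i\<in>I. K i))"
    by (intro brunn_minkowski_compact compact_sum_sets sum_sets_nonempty) auto
  then show ?case
    using insert by simp
qed simp

subsection \<open>Sums of boundaries\<close>

text \<open>The space is connected, so only itself and the empty set are clopen, and it is
  unbounded. Below, this replaces arguments about components of complements.\<close>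

lemma compact_open_empty:
  fixes S :: "'a::euclidean_space set"
  assumes "compact S" "open S"
  shows "S = {}"
  using assms clopen[of S] compact_imp_closed compact_imp_bounded not_bounded_UNIV by blast

text \<open>By connectedness \<open>frontier P\<close> lies outside or inside \<open>Q\<close>.
  Outside, \<open>Q \<inter> P\<close> is both compact and open. Inside, \<open>P\<close> lies in
  the interior of \<open>Q\<close>, and the volumes force it to fill that interior, so that
  \<open>P\<close> is both compact and open.\<close>

lemma compact_disjoint_of_frontier_disjoint:
  fixes P Q :: "'a::euclidean_space set"
  assumes P: "compact P" and Q: "compact Q" and conn: "connected (frontier P)"
    and disj: "frontier Q \<inter> P = {}" and le: "measure lebesgue Q \<le> measure lebesgue P"
  shows "Q \<inter> P = {}"
proof (rule ccontr)
  assume ne: "Q \<inter> P \<noteq> {}"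
  have fr: "frontier P \<subseteq> P" "frontier Q \<subseteq> Q" "P - frontier P = interior P" "Q - frontier Q = interior Q"
    using P Q by (auto simp: frontier_subset_closed compact_imp_closed frontier_def closure_closed
        dest: subsetD[OF interior_subset])
  have "frontier P \<inter> Q = {} \<or> frontier P \<subseteq> Q"
    using connected_Int_frontier[OF conn, of Q] disj fr by blast
  then show False
  proof
    assume "frontier P \<inter> Q = {}"
    then have "Q \<inter> P = interior Q \<inter> interior P"
      using fr disj interior_subset by blast
    then have "open (Q \<inter> P)"
      by auto
    then show False
      using compact_open_empty ne P Q by blast
  next
    assume sub: "frontier P \<subseteq> Q"
    have "P - interior Q = interior P - Q"
      using sub disj fr interior_subset by blast
    moreover have "open (interior P - Q)" "compact (P - interior Q)"
      using P Q by (auto simp: compact_imp_closed intro: compact_diff)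
    ultimately have PQ: "P \<subseteq> interior Q"
      using compact_open_empty by fastforce
    have op: "open (interior Q - P)"
      using P by (simp add: compact_imp_closed open_Diff)
    have "measure lebesgue (interior Q - P) = measure lebesgue (interior Q) - measure lebesgue P"
      using PQ P Q by (intro measurable_measure_Diff)
        (auto simp: lmeasurable_compact fmeasurableD lmeasurable_interior compact_imp_bounded)
    also have "\<dots> \<le> measure lebesgue Q - measure lebesgue P"
      using Q by (intro diff_right_mono measure_mono_fmeasurable)
        (auto simp: interior_subset lmeasurable_compact)
    also have "\<dots> \<le> 0"
      using le by simp
    finally have "measure lebesgue (interior Q - P) = 0"
      by (simp add: measure_le_0_iff)
    moreover have "interior Q - P \<in> lmeasurable"
      using Q op by (intro lmeasurable_open) (meson bounded_subset compact_imp_bounded Diff_subset interior_subset)+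
    ultimately have "negligible (interior Q - P)"
      by (simp add: negligible_iff_measure)
    then have "interior Q - P = {}"
      using open_not_negligible op by blast
    then have "P = interior Q"
      using PQ by auto
    then have "P = {}"
      using compact_open_empty[OF P] by simp
    then show False
      using ne by simp
  qed
qed

text \<open>The same alternative for \<open>frontier P\<close>: if it misses \<open>Q\<close>, then
  \<open>Q - interior P\<close> is compact and open, and otherwise \<open>P \<union> Q\<close>
  is.\<close>

lemma subset_interior_of_frontier_subset:
  fixes P Q :: "'a::euclidean_space set"
  assumes P: "compact P" and Q: "compact Q" and conn: "connected (frontier P)"
    and sub: "frontier Q \<subseteq> interior P"
  shows "Q \<subseteq> interior P"
proof -
  have fr: "frontier P \<subseteq> P" "frontier Q \<subseteq> Q" "P - frontier P = interior P" "Q - frontier Q = interior Q"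
    using P Q by (auto simp: frontier_subset_closed compact_imp_closed frontier_def closure_closed
        dest: subsetD[OF interior_subset])
  have "frontier P \<inter> Q = {} \<or> frontier P \<subseteq> Q"
    using connected_Int_frontier[OF conn, of Q] sub fr by blast
  then show ?thesis
  proof
    assume "frontier P \<inter> Q = {}"
    then have "Q - interior P = interior Q - P"
      using fr sub interior_subset by blast
    moreover have "open (interior Q - P)" "compact (Q - interior P)"
      using P Q by (auto simp: compact_imp_closed intro: compact_diff)
    ultimately show ?thesis
      using compact_open_empty by fastforce
  next
    assume "frontier P \<subseteq> Q"
    then have "P \<union> Q = interior P \<union> interior Q"
      using fr sub interior_subset by blast
    moreover have "open (interior P \<union> interior Q)" "compact (P \<union> Q)"
      using P Q by auto
    ultimately show ?thesis
      using compact_open_empty by fastforce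
  qed
qed

lemma frontier_reflect:
  fixes S :: "'a::euclidean_space set"
  shows "frontier ((\<lambda>y. x - y) ` S) = (\<lambda>y. x - y) ` frontier S"
proof -
  have "(\<lambda>y. x - y) ` T = (+) x ` uminus ` T" for T :: "'a set"
    by (simp add: image_image)
  moreover have "closure (uminus ` S) = uminus ` closure S"
    using closure_injective_linear_image[of uminus S] by (simp add: linear_uminus)
  then have "frontier (uminus ` S) = uminus ` frontier S"
    by (simp add: frontier_def interior_negations image_set_diff)
  ultimately show ?thesis
    by (simp only: frontier_translation)
qed

lemma measure_reflect: "measure lebesgue ((\<lambda>y. x - y) ` S) = measure lebesgue S"
  for x :: "'a::euclidean_space"
  using measure_lebesgue_affine[of "-1" x S] by simp

lemma compact_reflect: "compact S \<Longrightarrow> compact ((\<lambda>y. x - y) ` S)"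
  for x :: "'a::euclidean_space"
  by (intro compact_continuous_image continuous_intros)

text \<open>For \<open>x\<close> in \<open>P + Q\<close> the reflected copy \<open>x - Q\<close>
  meets \<open>P\<close>. As its volume is at most that of \<open>P\<close>, its frontier must meet
  \<open>P\<close> too, which puts \<open>x\<close> in \<open>P + frontier Q\<close>.\<close>

lemma set_plus_frontier_eq:
  fixes P Q :: "'a::euclidean_space set"
  assumes "compact P" "compact Q" "connected (frontier P)" "measure lebesgue Q \<le> measure lebesgue P"
  shows "P + frontier Q = P + Q"
proof
  show "P + frontier Q \<subseteq> P + Q"
    using assms by (intro set_plus_mono2) (auto simp: frontier_subset_closed compact_imp_closed)
  show "P + Q \<subseteq> P + frontier Q"
  proof
    fix x assume "x \<in> P + Q"
    then obtain p q where "x = p + q" "p \<in> P" "q \<in> Q"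
      by (rule set_plus_elim)
    then have "(\<lambda>y. x - y) ` Q \<inter> P \<noteq> {}"
      by (metis IntI add_diff_cancel_right' empty_iff image_eqI)
    then have "frontier ((\<lambda>y. x - y) ` Q) \<inter> P \<noteq> {}"
      using compact_disjoint_of_frontier_disjoint[OF assms(1) compact_reflect[OF assms(2)] assms(3)] assms(4)
      by (metis measure_reflect)
    then obtain y where "y \<in> frontier Q" "x - y \<in> P"
      by (auto simp: frontier_reflect)
    then show "x \<in> P + frontier Q"
      using set_plus_intro[of "x - y" P y "frontier Q"] by simp
  qed
qed

text \<open>The summands are replaced by their frontiers one at a time; \<open>P\<close> remains
  whole as the set that dominates each of them in volume.\<close>

lemma set_plus_sum_frontier_eq:
  fixes P :: "'a::euclidean_space set"
  assumes "compact P" "connected (frontier P)" "finite J"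
    and "\<And>j. j \<in> J \<Longrightarrow> compact (K j)" "\<And>j. j \<in> J \<Longrightarrow> measure lebesgue (K j) \<le> measure lebesgue P"
  shows "P + (\<Sum>j\<in>J. frontier (K j)) = P + (\<Sum>j\<in>J. K j)"
  using assms(3-)
proof (induction J rule: finite_induct)
  case (insert j J)
  have "P + (\<Sum>i\<in>insert j J. frontier (K i)) = (P + frontier (K j)) + (\<Sum>i\<in>J. frontier (K i))"
    using insert by (simp add: add.assoc)
  also have "\<dots> = (P + K j) + (\<Sum>i\<in>J. frontier (K i))"
    using assms insert by (subst set_plus_frontier_eq) auto
  also have "\<dots> = (P + (\<Sum>i\<in>J. frontier (K i))) + K j"
    by (simp add: ac_simps)
  also have "\<dots> = P + (\<Sum>i\<in>insert j J. K i)"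
    using insert by (simp add: ac_simps)
  finally show ?case .
qed simp

text \<open>One summand at a time: with the contribution of the others fixed, the frontier of a
  reflected copy of \<open>K j\<close> lies in the interior of \<open>P\<close>, and hence the whole
  copy does.\<close>

lemma diff_sum_subset_interior:
  fixes P :: "'a::euclidean_space set"
  assumes "compact P" "connected (frontier P)" "finite J" "\<And>j. j \<in> J \<Longrightarrow> compact (K j)"
    and "\<And>y. y \<in> (\<Sum>j\<in>J. frontier (K j)) \<Longrightarrow> x - y \<in> interior P"
  shows "\<forall>y \<in> (\<Sum>j\<in>J. K j). x - y \<in> interior P"
  using assms(3-)
proof (induction J arbitrary: x rule: finite_induct)
  case (insert j J)
  show ?case
  proof
    fix y assume "y \<in> (\<Sum>i\<in>insert j J. K i)"
    then obtain a b where y: "y = a + b" and a: "a \<in> K j" and b: "b \<in> (\<Sum>i\<in>J. K i)"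
      using insert.hyps by (auto elim: set_plus_elim)
    have "(x - b) - t \<in> interior P" if t: "t \<in> frontier (K j)" for t
    proof -
      have "x - t - s \<in> interior P" if "s \<in> (\<Sum>i\<in>J. frontier (K i))" for s
        using insert.prems(2)[of "t + s"] insert.hyps t that
        by (auto simp: diff_diff_eq intro!: set_plus_intro)
      then show ?thesis
        using insert.IH[of "x - t"] insert.prems(1) b by (simp add: algebra_simps)
    qed
    then have "frontier ((\<lambda>y. (x - b) - y) ` K j) \<subseteq> interior P"
      by (auto simp: frontier_reflect)
    then have "(\<lambda>y. (x - b) - y) ` K j \<subseteq> interior P"
      using subset_interior_of_frontier_subset[OF assms(1) compact_reflect assms(2)] insert.prems(1) by blast
    then show "x - y \<in> interior P"
      using a y by (auto simp: image_subset_iff diff_diff_eq add.commute)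
  qed
qed simp

text \<open>The reflected sum \<open>x - ?S\<close> of the frontiers is connected and, as
  \<open>P + ?S = P + ?L\<close>, meets \<open>P\<close>. If it misses \<open>frontier P\<close>, it
  lies in the interior of \<open>P\<close>; then so does \<open>x - ?L\<close>, and \<open>x\<close>
  belongs to the set removed on the left.\<close>

lemma sum_frontiers_superset:
  fixes P :: "'a::euclidean_space set"
  assumes P: "compact P" "connected (frontier P)" and J: "finite J"
    and K: "\<And>j. j \<in> J \<Longrightarrow> compact (K j)" "\<And>j. j \<in> J \<Longrightarrow> connected (frontier (K j))"
      "\<And>j. j \<in> J \<Longrightarrow> measure lebesgue (K j) \<le> measure lebesgue P"
  shows "(P + (\<Sum>j\<in>J. K j)) - {x. \<forall>y \<in> (\<Sum>j\<in>J. K j). x - y \<in> P}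
    \<subseteq> frontier P + (\<Sum>j\<in>J. frontier (K j))"
proof (rule ccontr)
  let ?S = "\<Sum>j\<in>J. frontier (K j)" and ?L = "\<Sum>j\<in>J. K j"
  assume "\<not> ?thesis"
  then obtain x where x: "x \<in> P + ?L" "x \<notin> frontier P + ?S" and nb: "\<not> (\<forall>y \<in> ?L. x - y \<in> P)"
    by blast
  have "x \<in> P + ?S"
    using x set_plus_sum_frontier_eq[OF P J K(1,3)] by simp
  then obtain p s where "x = p + s" "p \<in> P" "s \<in> ?S"
    by (rule set_plus_elim)
  then have meets: "(\<lambda>y. x - y) ` ?S \<inter> P \<noteq> {}"
    by (metis IntI add_diff_cancel_right' empty_iff image_eqI)
  have avoids: "(\<lambda>y. x - y) ` ?S \<inter> frontier P = {}"
  proof (rule ccontr)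
    assume "(\<lambda>y. x - y) ` ?S \<inter> frontier P \<noteq> {}"
    then obtain s where "s \<in> ?S" "x - s \<in> frontier P"
      by auto
    then show False
      using x(2) set_plus_intro[of "x - s" "frontier P" s ?S] by simp
  qed
  have "connected ((\<lambda>y. x - y) ` ?S)"
    by (intro connected_continuous_image continuous_intros connected_sum_sets K)
  then have "(\<lambda>y. x - y) ` ?S \<subseteq> P"
    using connected_Int_frontier meets avoids by blast
  then have "(\<lambda>y. x - y) ` ?S \<subseteq> interior P"
    using avoids P(1) by (auto simp: frontier_def closure_closed compact_imp_closed)
  then have "\<forall>y \<in> ?L. x - y \<in> interior P"
    using diff_sum_subset_interior[OF P J, of K x] K(1) by (simp add: image_subset_iff)
  then show False
    using nb interior_subset by blast
qed

subsection \<open>The lower bound\<close>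

text \<open>\<open>r - s\<close> and \<open>2 * sqrt (r * s)\<close> are the legs of a right
  triangle with hypotenuse \<open>r + s\<close>, and for exponents from 2 on the powers of the legs
  sum to at most that of the hypotenuse.\<close>

lemma power_diff_ge_geometric:
  fixes r s :: real
  assumes "2 \<le> n" "0 \<le> s" "s \<le> r"
  shows "(2 * sqrt (r * s)) ^ n + (r - s) ^ n \<le> (r + s) ^ n"
proof -
  define x y z where "x = r - s" and "y = 2 * sqrt (r * s)" and "z = r + s"
  have pyth: "x\<^sup>2 + y\<^sup>2 = z\<^sup>2"
    using assms by (simp add: x_def y_def z_def power2_eq_square algebra_simps)
  have nn: "0 \<le> x" "0 \<le> y" "0 \<le> z"
    using assms by (auto simp: x_def y_def z_def)
  have "x \<le> z"
    using assms by (simp add: x_def z_def)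
  have "y\<^sup>2 \<le> z\<^sup>2"
    unfolding pyth[symmetric] by simp
  then have "y \<le> z"
    using nn(3) by (rule power2_le_imp_le)
  define k where "k = n - 2"
  then have n: "n = 2 + k"
    using assms by simp
  have "y ^ n + x ^ n \<le> y\<^sup>2 * z ^ k + x\<^sup>2 * z ^ k"
    unfolding n power_add using nn \<open>x \<le> z\<close> \<open>y \<le> z\<close> by (intro add_mono mult_left_mono power_mono) auto
  also have "\<dots> = z ^ n"
    unfolding n power_add using pyth by (metis add.commute distrib_right)
  finally show ?thesis
    by (simp add: x_def y_def z_def)
qed

text \<open>Bernoulli's inequality for \<open>(1 + x) ^ k\<close>, where
  \<open>1 + x = 2 * k / (k + 1)\<close>. Later \<open>k\<close> counts the sets besides the
  largest. At \<open>k = 1\<close> both sides equal 4, so strictness comes from having at least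
  three sets.\<close>

lemma Suc_power_less:
  assumes "2 \<le> k"
  shows "(real k + 1) ^ (k + 1) < 2 ^ (k + 1) * real k ^ k"
proof -
  have k: "0 < real k"
    using assms by simp
  define x where "x = (real k - 1) / (real k + 1)"
  have x: "0 < x" "1 + x = 2 * k / (k + 1)"
    using assms by (auto simp: x_def field_simps)
  have "real k = 1 + (real k + 1) * x"
    by (simp add: x_def)
  also have "\<dots> < (1 + x) * (1 + k * x)"
    using mult_pos_pos[OF k mult_pos_pos[OF x(1) x(1)]] by (simp add: algebra_simps)
  also have "\<dots> \<le> (1 + x) * (1 + x) ^ k"
    using x Bernoulli_inequality[of x k] by (intro mult_left_mono) auto
  also have "\<dots> = (2 * k / (k + 1)) ^ (k + 1)"
    using x(2) by simp
  finally have "real k < (2 * real k) ^ (k + 1) / (real k + 1) ^ (k + 1)"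
    by (simp only: power_divide) (simp add: add.commute)
  then have "real k * (real k + 1) ^ (k + 1) < (2 * real k) ^ (k + 1)"
    by (subst (asm) pos_less_divide_eq) (auto intro!: zero_less_power)
  also have "\<dots> = real k * (2 ^ (k + 1) * real k ^ k)"
    by (simp add: power_mult_distrib)
  finally show ?thesis
    using k by (simp add: add.commute)
qed

text \<open>Here \<open>r\<close> is the volume radius of the largest set, and \<open>t j\<close>
  are those of the others. AM-GM bounds \<open>prod t J\<close> by \<open>(s / k) ^ k\<close>, and
  \<open>Suc_power_less\<close> makes the estimate strict.\<close>

lemma geometric_mean_less:
  fixes r s :: real and t :: "'i \<Rightarrow> real"
  assumes "finite J" "2 \<le> card J" and t: "\<And>j. j \<in> J \<Longrightarrow> 0 < t j" and s: "sum t J \<le> s" "s \<le> r"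
  shows "(card J + 1) * root (card J + 1) (r * prod t J) < 2 * sqrt (r * s)"
proof -
  define k where "k = card J"
  have J: "J \<noteq> {}"
    using assms(2) by auto
  then have "0 < sum t J"
    using t assms(1) by (intro sum_pos) auto
  then have s0: "0 < s" "0 < r"
    using s by auto
  have k: "2 \<le> k" "0 < real k"
    using assms(2) by (auto simp: k_def)
  define G where "G = root (k + 1) (r * prod t J)"
  have pt: "0 < prod t J"
    using t by (simp add: prod_pos)
  have G: "0 < G"
    unfolding G_def using pt s0 by simp
  have Gk: "G ^ (k + 1) = r * prod t J"
    unfolding G_def using pt s0 by (intro real_root_pow_pos2) auto
  have "root k (prod t J) \<le> s / k"
    using root_prod_le_mean[OF assms(1) J t] s k unfolding k_def by (meson divide_right_mono of_nat_0_le_iff order_trans)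
  then have "root k (prod t J) ^ k \<le> (s / k) ^ k"
    using pt k by (intro power_mono) auto
  then have "prod t J \<le> (s / k) ^ k"
    using pt k by simp
  then have "G ^ (k + 1) \<le> r * (s / k) ^ k"
    unfolding Gk using s0 by simp
  then have "((real k + 1) * G) ^ (k + 1) \<le> (real k + 1) ^ (k + 1) * (r * (s / k) ^ k)"
    unfolding power_mult_distrib by (intro mult_left_mono) auto
  also have "\<dots> < (2 ^ (k + 1) * real k ^ k) * (r * (s / k) ^ k)"
    using Suc_power_less[OF k(1)] s0 k by (intro mult_strict_right_mono) (auto simp: add.commute)
  also have "\<dots> = 2 ^ (k + 1) * (r * s ^ k)"
    using k by (simp add: power_divide)
  \<comment> \<open>In the square, replacing \<open>k - 1\<close> of the factors \<open>s\<close> by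
    \<open>r\<close> balances the exponents.\<close>
  also have "r * s ^ k \<le> sqrt (r * s) ^ (k + 1)"
  proof (rule power2_le_imp_le)
    have "k * 2 = (k - 1) + (k + 1)"
      using k by simp
    then have "(s ^ k)\<^sup>2 = s ^ (k - 1) * s ^ (k + 1)"
      by (simp only: power_mult[symmetric] power_add[symmetric])
    then have "(r * s ^ k)\<^sup>2 = r ^ 2 * s ^ (k - 1) * s ^ (k + 1)"
      by (simp add: power_mult_distrib)
    also have "\<dots> \<le> r ^ 2 * r ^ (k - 1) * s ^ (k + 1)"
      using s s0 by (intro mult_right_mono mult_left_mono power_mono) auto
    also have "\<dots> = (r * s) ^ (k + 1)"
      using k by (simp add: power_mult_distrib flip: power_add)
    also have "\<dots> = (sqrt (r * s) ^ (k + 1))\<^sup>2"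
      using s0 by (metis less_imp_le mult_pos_pos power_mult mult.commute real_sqrt_pow2)
    finally show "(r * s ^ k)\<^sup>2 \<le> (sqrt (r * s) ^ (k + 1))\<^sup>2" .
  qed (use s0 in auto)
  finally have "((real k + 1) * G) ^ (k + 1) < (2 * sqrt (r * s)) ^ (k + 1)"
    by (simp only: power_mult_distrib) simp
  then show ?thesis
    unfolding k_def[symmetric] G_def[symmetric] using s0 power_less_imp_less_base[of "(real k + 1) * G" "k + 1" "2 * sqrt (r * s)"]
    by (simp only: of_nat_add of_nat_1) simp
qed

text \<open>The first alternative arises when some translate of the reflected sum of the other sets
  fits into the largest one, and it is strict. Equality in the theorem is thus possible only in the
  second, where Brunn-Minkowski for the full sum takes over.\<close>

lemma sum_frontiers_dichotomy:
  fixes K :: "'i \<Rightarrow> 'a::euclidean_space set"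
  assumes n: "2 \<le> DIM('a)" and I: "finite I" "3 \<le> card I"
    and K: "\<And>i. i \<in> I \<Longrightarrow> compact (K i)" "\<And>i. i \<in> I \<Longrightarrow> connected (frontier (K i))"
      "\<And>i. i \<in> I \<Longrightarrow> 0 < measure lebesgue (K i)"
  shows "(card I * root (card I) (\<Prod>i\<in>I. vrad (K i))) ^ DIM('a) < measure lebesgue (\<Sum>i\<in>I. frontier (K i))
    \<or> measure lebesgue (\<Sum>i\<in>I. K i) \<le> measure lebesgue (\<Sum>i\<in>I. frontier (K i))"
proof -
  let ?v = "measure lebesgue :: 'a set \<Rightarrow> real" and ?n = "DIM('a)"
  have "Max ((\<lambda>i. ?v (K i)) ` I) \<in> (\<lambda>i. ?v (K i)) ` I"
    using I by (intro Max_in) auto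
  then obtain k where k: "k \<in> I" "?v (K k) = Max ((\<lambda>i. ?v (K i)) ` I)"
    by auto
  have kmax: "?v (K i) \<le> ?v (K k)" if "i \<in> I" for i
    unfolding k(2) using I that by simp
  define J where "J = I - {k}"
  have J: "finite J" "J \<subseteq> I" "k \<notin> J" "I = insert k J" "card I = card J + 1"
    using I k by (auto simp: J_def card_Suc_Diff1)
  have ne: "K i \<noteq> {}" if "i \<in> I" for i
    using K(3)[OF that] by auto
  define L S where "L = (\<Sum>i\<in>J. K i)" and "S = (\<Sum>i\<in>I. frontier (K i))"
  define B where "B = {x. \<forall>y \<in> L. x - y \<in> K k}"
  have sumK: "(\<Sum>i\<in>I. K i) = K k + L" and S: "S = frontier (K k) + (\<Sum>i\<in>J. frontier (K i))"
    using J by (simp_all add: L_def S_def)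
  have cL: "compact L" "L \<noteq> {}" and cS: "compact S"
    unfolding L_def S_def using J(2) K ne by (intro compact_sum_sets sum_sets_nonempty compact_frontier; blast)+
  have ck: "compact (K k)"
    using K k by simp
  \<comment> \<open>In this form \<open>B\<close> is visibly closed and contained in a translate of
    \<open>K k\<close>, hence compact.\<close>
  have B: "B = (\<Inter>y\<in>L. (+) y ` K k)"
    by (auto simp: B_def image_iff) (metis add_diff_cancel_left' diff_add_cancel add.commute)+
  have "closed B"
    unfolding B using ck by (intro closed_INT ballI compact_imp_closed compact_translation)
  moreover obtain y where "y \<in> L"
    using cL by auto
  then have "B \<subseteq> (+) y ` K k"
    unfolding B by blast
  ultimately have cB: "compact B"
    using compact_translation[OF ck, of y] compact_Int_closed inf_absorb2 by metis
  have "(K k + L) - B \<subseteq> S"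
    unfolding S B_def L_def using J(2) kmax
    by (intro sum_frontiers_superset ck K(1,2) k(1) J(1)) auto
  then have "K k + L \<subseteq> S \<union> B"
    by blast
  then have "?v (K k + L) \<le> ?v (S \<union> B)"
    using cL cS cB ck by (intro measure_lebesgue_mono) (auto intro: compact_set_plus)
  also have "\<dots> \<le> ?v S + ?v B"
    using cS cB by (intro measure_Un_le) (auto intro: lmeasurable_compact fmeasurableD)
  finally have le: "?v (K k + L) \<le> ?v S + ?v B" .
  show ?thesis
  proof (cases "B = {}")
    case True
    then show ?thesis
      using le by (simp add: sumK S_def)
  next
    case False
    define r s where "r = vrad (K k)" and "s = vrad L"
    \<comment> \<open>Brunn-Minkowski turns this inclusion into \<open>vrad B \<le> r - s\<close>;
      since \<open>vrad B\<close> is nonnegative, it also yields \<open>s \<le> r\<close>.\<close>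
    have "B + uminus ` L \<subseteq> K k"
      by (auto simp: B_def set_plus_def)
    moreover have cN: "compact (uminus ` L)"
      using compact_reflect[OF cL(1), of 0] by simp
    ultimately have "?v (B + uminus ` L) \<le> ?v (K k)"
      using cB ck by (intro measure_lebesgue_mono compact_set_plus)
    then have "vrad B + vrad (uminus ` L) \<le> r"
      unfolding r_def using brunn_minkowski_compact[OF cB False cN] cL(2) vrad_mono by fastforce
    moreover have "vrad (uminus ` L) = s"
      using measure_reflect[of 0 L] by (simp add: s_def vrad_def)
    ultimately have Bs: "vrad B \<le> r - s"
      by simp
    then have "?v B \<le> (r - s) ^ ?n"
      by (metis power_mono vrad_nonneg vrad_pow)
    moreover have "(r + s) ^ ?n \<le> ?v (K k + L)"
      using brunn_minkowski_compact[OF ck ne[OF k(1)] cL] unfolding r_def s_def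
      by (metis add_nonneg_nonneg power_mono vrad_nonneg vrad_pow)
    moreover have sr: "0 \<le> s" "s \<le> r"
      using Bs order_trans[OF vrad_nonneg Bs] by (simp_all add: s_def)
    ultimately have "(2 * sqrt (r * s)) ^ ?n \<le> ?v S"
      using le power_diff_ge_geometric[OF n, of s r] by linarith
    moreover have "card I * root (card I) (\<Prod>i\<in>I. vrad (K i)) < 2 * sqrt (r * s)"
    proof -
      have "(\<Sum>i\<in>J. vrad (K i)) \<le> s"
        unfolding s_def L_def using J K ne by (intro brunn_minkowski_sum) auto
      then have "(card J + 1) * root (card J + 1) (r * (\<Prod>i\<in>J. vrad (K i))) < 2 * sqrt (r * s)"
        using J K I sr by (intro geometric_mean_less) auto
      then show ?thesis
        using J by (simp add: r_def)
    qed
    moreover have "0 \<le> card I * root (card I) (\<Prod>i\<in>I. vrad (K i))"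
      by (intro mult_nonneg_nonneg real_root_ge_zero prod_nonneg) auto
    ultimately have "(card I * root (card I) (\<Prod>i\<in>I. vrad (K i))) ^ ?n < ?v S"
      using power_strict_mono[of _ "2 * sqrt (r * s)" ?n] by fastforce
    then show ?thesis
      by (simp add: S_def)
  qed
qed

subsection \<open>Equality in the Brunn-Minkowski inequality for equal volumes\<close>

abbreviation cut_vol :: "'a::euclidean_space set \<Rightarrow> 'a \<Rightarrow> real \<Rightarrow> real" where
  "cut_vol A u t \<equiv> measure lebesgue (A \<inter> {x. u \<bullet> x \<le> t})"

lemma cut_vol_mono:
  assumes "compact A" "s \<le> t"
  shows "cut_vol A u s \<le> cut_vol A u t"
  using assms by (intro measure_lebesgue_mono compact_Int_halfspace_le) auto

lemma cut_vol_le: "compact A \<Longrightarrow> cut_vol A u t \<le> measure lebesgue A"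
  by (intro measure_lebesgue_mono compact_Int_halfspace_le) auto

text \<open>The frontier of a convex set is null, so it cannot contain \<open>B\<close>.\<close>

lemma convex_interior_meets:
  fixes A :: "'a::euclidean_space set"
  assumes "convex A" "B \<subseteq> A" "0 < measure lebesgue B"
  shows "interior A \<inter> B \<noteq> {}"
proof
  assume "interior A \<inter> B = {}"
  then have "B \<subseteq> frontier A"
    using assms(2) closure_subset by (auto simp: frontier_def)
  then have "negligible B"
    using negligible_convex_frontier[OF assms(1)] negligible_subset by blast
  then show False
    using assms(3) by (simp add: negligible_imp_measure0)
qed

text \<open>The interior has points at heights at most \<open>s\<close> and at least
  \<open>t\<close>, hence, being connected, also one strictly between. A neighbourhood of that point
  inside the slab has positive volume.\<close>

lemma cut_vol_strict_mono:
  assumes A: "compact A" "convex A" "u \<noteq> 0" and "s < t"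
    and s: "0 < cut_vol A u s" and t: "cut_vol A u t < measure lebesgue A"
  shows "cut_vol A u s < cut_vol A u t"
proof (rule ccontr)
  assume "\<not> ?thesis"
  then have eq: "cut_vol A u t = cut_vol A u s"
    using cut_vol_mono[OF A(1), of s t u] \<open>s < t\<close> by simp
  obtain p where p: "p \<in> interior A" "u \<bullet> p \<le> s"
    using convex_interior_meets[OF A(2) _ s] by auto
  have "0 < measure lebesgue (A \<inter> {x. u \<bullet> x \<ge> t})"
    using t measure_cut[OF A(1,3), of t] by simp
  then obtain q where q: "q \<in> interior A" "t \<le> u \<bullet> q"
    using convex_interior_meets[OF A(2), of "A \<inter> {x. u \<bullet> x \<ge> t}"] by auto
  have "\<exists>z\<in>interior A. u \<bullet> z = (s + t) / 2"
    using p q \<open>s < t\<close> A(2)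
    by (intro connected_ivt_hyperplane[of _ p q] convex_connected convex_interior) auto
  then obtain z where z: "z \<in> interior A" "u \<bullet> z = (s + t) / 2"
    by auto
  define N where "N = interior A \<inter> {x. s < u \<bullet> x} \<inter> {x. u \<bullet> x < t}"
  have "open N"
    unfolding N_def by (intro open_Int open_interior open_halfspace_lt open_halfspace_gt)
  have "z \<in> N"
    using z \<open>s < t\<close> by (simp add: N_def)
  define D where "D = (A \<inter> {x. u \<bullet> x \<le> t}) - (A \<inter> {x. u \<bullet> x \<le> s})"
  have m: "A \<inter> {x. u \<bullet> x \<le> t} \<in> lmeasurable" "A \<inter> {x. u \<bullet> x \<le> s} \<in> lmeasurable" for t s
    using A(1) by (simp_all add: lmeasurable_compact compact_Int_halfspace_le)
  have "measure lebesgue D = cut_vol A u t - cut_vol A u s"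
    unfolding D_def using \<open>s < t\<close> m by (intro measurable_measure_Diff) auto
  then have "negligible D"
    using eq m by (auto simp: D_def negligible_iff_measure intro!: fmeasurable_Diff)
  moreover have "N \<subseteq> D"
    using interior_subset by (fastforce simp: N_def D_def)
  ultimately show False
    using open_not_negligible[OF \<open>open N\<close>] \<open>z \<in> N\<close> negligible_subset by blast
qed

text \<open>A convex set of positive volume lies in the closure of its interior, so the open
  half-space around \<open>x\<close> meets the interior in a nonempty open set.\<close>

lemma cut_vol_pos:
  assumes A: "compact A" "convex A" "0 < measure lebesgue A" and x: "x \<in> A" "u \<bullet> x < t"
  shows "0 < cut_vol A u t"
proof -
  have int: "interior A \<noteq> {}"
    using convex_interior_meets[OF A(2) subset_refl A(3)] by auto
  then have "x \<in> closure (interior A)"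
    using convex_closure_interior[OF A(2)] x(1) closure_subset by blast
  moreover have "open {x. u \<bullet> x < t}"
    by (rule open_halfspace_lt)
  ultimately have "interior A \<inter> {x. u \<bullet> x < t} \<noteq> {}"
    using x(2) open_Int_closure_eq_empty[of "{x. u \<bullet> x < t}" "interior A"] by blast
  then have "\<not> negligible (interior A \<inter> {x. u \<bullet> x < t})"
    by (intro open_not_negligible open_Int open_interior open_halfspace_lt)
  moreover have "interior A \<inter> {x. u \<bullet> x < t} \<subseteq> A \<inter> {x. u \<bullet> x \<le> t}"
    using interior_subset by fastforce
  ultimately have "\<not> negligible (A \<inter> {x. u \<bullet> x \<le> t})"
    using negligible_subset by blast
  then show ?thesis
    using A(1) by (auto simp: negligible_iff_measure lmeasurable_compact compact_Int_halfspace_le zero_less_measure_iff)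
qed

text \<open>Brunn-Minkowski followed by AM-GM for the two volume radii. This multiplicative form
  also covers empty sets, so it applies to arbitrary cut pieces.\<close>

lemma measure_sum_ge_sqrt:
  fixes A B :: "'a::euclidean_space set"
  assumes "compact A" "compact B"
  shows "2 ^ DIM('a) * sqrt (measure lebesgue A * measure lebesgue B) \<le> measure lebesgue (A + B)"
proof (cases "A = {} \<or> B = {}")
  case False
  have "(2 * sqrt (vrad A * vrad B)) ^ DIM('a) \<le> vrad (A + B) ^ DIM('a)"
  proof (rule power_mono)
    have "2 * sqrt (vrad A * vrad B) \<le> vrad A + vrad B"
      using arith_geo_mean_sqrt[of "vrad A" "vrad B"] by simp
    then show "2 * sqrt (vrad A * vrad B) \<le> vrad (A + B)"
      using brunn_minkowski_compact[of A B] assms False by simp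
  qed simp
  then show ?thesis
    by (simp add: power_mult_distrib vrad_pow flip: real_sqrt_power)
qed auto

text \<open>Each increment of \<open>b\<close> along the grid of step \<open>k\<close> is at most
  the next increment of \<open>a\<close>, by the exchange inequality at the grid point between them.
  Summation telescopes, with \<open>b\<close> lagging one step behind.\<close>

lemma exp_grid_increment:
  fixes a b :: "real \<Rightarrow> real"
  assumes "\<And>x h. x + h < w \<Longrightarrow> x - h < w \<Longrightarrow> a x + b x \<le> a (x + h) + b (x - h)"
    and "0 \<le> k" "x + real N * k < w"
  shows "b (x + real N * k - k) - b (x - k) \<le> a (x + real N * k) - a x"
  using assms(3)
proof (induction N)
  case (Suc N)
  have "x + real N * k + k < w"
    using Suc.prems by (simp add: algebra_simps)
  moreover from this have "x + real N * k - k < w"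
    using assms(2) by linarith
  ultimately have step: "a (x + real N * k) + b (x + real N * k) \<le> a (x + real N * k + k) + b (x + real N * k - k)"
    by (rule assms(1))
  have IH: "b (x + real N * k - k) - b (x - k) \<le> a (x + real N * k) - a x"
    using \<open>x + real N * k + k < w\<close> assms(2) by (intro Suc.IH) linarith
  have eq: "x + real (Suc N) * k = x + real N * k + k"
    by (simp add: algebra_simps)
  show ?case
    unfolding eq using step IH by simp
qed simp

text \<open>Refining the grid removes the lag of \<open>b\<close>: at the right end it costs at most
  \<open>e\<close> by \<open>left\<close>, and at the left end \<open>mono\<close> absorbs
  it.\<close>

lemma increment_le_of_exchange:
  fixes a b :: "real \<Rightarrow> real"
  assumes ex: "\<And>x h. x + h < w \<Longrightarrow> x - h < w \<Longrightarrow> a x + b x \<le> a (x + h) + b (x - h)"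
    and mono: "\<And>x y. x \<le> y \<Longrightarrow> y < w \<Longrightarrow> b x \<le> b y"
    and left: "\<And>y e. y < w \<Longrightarrow> 0 < e \<Longrightarrow> \<exists>z<y. b y - e \<le> b z"
    and "x < y" "y < w"
  shows "b y - b x \<le> a y - a x"
proof (rule field_le_epsilon)
  fix e :: real assume "0 < e"
  then obtain z where z: "z < y" "b y - e \<le> b z"
    using left \<open>y < w\<close> by blast
  \<comment> \<open>Large enough that the grid step \<open>k\<close> does not exceed
    \<open>y - z\<close>.\<close>
  obtain N :: nat where N: "(y - x) / (y - z) < real N"
    using reals_Archimedean2 by blast
  moreover have "0 < (y - x) / (y - z)"
    using z \<open>x < y\<close> by simp
  ultimately have N0: "0 < real N"
    by linarith
  define k where "k = (y - x) / N"
  have k: "0 < k" "x + real N * k = y" "z \<le> y - k"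
    using N N0 z \<open>x < y\<close> by (auto simp: k_def field_simps)
  have "b (y - k) - b (x - k) \<le> a y - a x"
    using exp_grid_increment[of w a b k x N, OF ex] k \<open>y < w\<close> by simp
  moreover have "b z \<le> b (y - k)" "b (x - k) \<le> b x"
    using k \<open>x < y\<close> \<open>y < w\<close> by (auto intro!: mono)
  ultimately show "b y - b x \<le> a y - a x + e"
    using z by linarith
qed

text \<open>The value of a quantile function outside the open interval from 0 to the volume is arbitrary.\<close>

definition quantile_of :: "(real \<Rightarrow> real) \<Rightarrow> 'a::euclidean_space set \<Rightarrow> 'a \<Rightarrow> bool" where
  "quantile_of a A u \<longleftrightarrow> (\<forall>p. 0 < p \<longrightarrow> p < measure lebesgue A \<longrightarrow> cut_vol A u (a p) = p)"

lemma exists_quantile: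
  assumes "compact A" "u \<noteq> 0"
  obtains a where "quantile_of a A u"
proof -
  have "\<forall>p. \<exists>t. 0 < p \<longrightarrow> p < measure lebesgue A \<longrightarrow> cut_vol A u t = p"
    using exists_cut[OF assms] by (metis less_imp_le)
  then show ?thesis
    using that unfolding quantile_of_def by metis
qed

lemma quantile_mono:
  assumes "compact A" "quantile_of a A u" "0 < p" "p \<le> q" "q < measure lebesgue A"
  shows "a p \<le> a q"
proof (rule ccontr)
  assume neg: "\<not> ?thesis"
  then have "cut_vol A u (a q) \<le> cut_vol A u (a p)"
    using assms(1) by (intro cut_vol_mono) auto
  then have "q \<le> p"
    using assms by (simp add: quantile_of_def)
  then show False
    using assms(4) neg by simp
qed

text \<open>Strict monotonicity puts the cut volume at height \<open>a p - e\<close> below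
  \<open>p\<close>; any \<open>q\<close> strictly between the two serves.\<close>

lemma quantile_left_cont:
  assumes A: "compact A" "convex A" "u \<noteq> 0" and a: "quantile_of a A u"
    and p: "0 < p" "p < measure lebesgue A" and "0 < e"
  shows "\<exists>q. 0 < q \<and> q < p \<and> a p - e \<le> a q"
proof -
  have cp: "cut_vol A u (a p) = p"
    using a p by (simp add: quantile_of_def)
  have "cut_vol A u (a p - e) < p"
  proof (cases "cut_vol A u (a p - e) = 0")
    case False
    then have "0 < cut_vol A u (a p - e)"
      by (simp add: zero_less_measure_iff)
    then show ?thesis
      using cut_vol_strict_mono[OF A, of "a p - e" "a p"] \<open>0 < e\<close> p cp by simp
  qed (use p in simp)
  then obtain q where q: "cut_vol A u (a p - e) < q" "q < p"
    using dense by blast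
  then have "0 < q"
    using measure_nonneg[of lebesgue "A \<inter> {x. u \<bullet> x \<le> a p - e}"] by linarith
  moreover have "a p - e \<le> a q"
  proof (rule ccontr)
    assume "\<not> ?thesis"
    then have "cut_vol A u (a q) \<le> cut_vol A u (a p - e)"
      using A(1) by (intro cut_vol_mono) auto
    moreover have "cut_vol A u (a q) = q"
      using a \<open>0 < q\<close> q p by (simp add: quantile_of_def)
    ultimately show False
      using q by simp
  qed
  ultimately show ?thesis
    using q by auto
qed

lemma cut_vol_sum_ge_sqrt:
  fixes K L :: "'a::euclidean_space set"
  assumes "compact K" "compact L"
  shows "2 ^ DIM('a) * sqrt (cut_vol K u s * cut_vol L u t) \<le> cut_vol (K + L) u (s + t)"
proof -
  have "2 ^ DIM('a) * sqrt (cut_vol K u s * cut_vol L u t)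
      \<le> measure lebesgue ((K \<inter> {x. u \<bullet> x \<le> s}) + (L \<inter> {x. u \<bullet> x \<le> t}))"
    by (intro measure_sum_ge_sqrt compact_Int_halfspace_le assms)
  also have "\<dots> \<le> cut_vol (K + L) u (s + t)"
    by (intro measure_lebesgue_mono compact_set_plus compact_Int_halfspace_le assms)
       (auto simp: set_plus_def inner_add_right intro: add_mono)
  finally show ?thesis .
qed

text \<open>With \<open>R = sqrt (P * Q)\<close>, the lower pieces give \<open>K + L\<close> volume
  at least \<open>2 ^ ?n * R\<close> below height \<open>a P + b Q\<close>. The upper pieces at
  \<open>a R\<close> and \<open>b R\<close> have volume \<open>V - R\<close> each, which leaves at
  most \<open>2 ^ ?n * R\<close> below \<open>a R + b R\<close>. So the first height cannot lie
  strictly below the second.\<close>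

lemma quantile_exchange:
  fixes K L :: "'a::euclidean_space set"
  assumes K: "compact K" "convex K" and L: "compact L" "convex L"
    and V: "measure lebesgue K = V" "measure lebesgue L = V"
    and eq: "measure lebesgue (K + L) \<le> 2 ^ DIM('a) * V" and u: "u \<noteq> 0"
    and a: "quantile_of a K u" and b: "quantile_of b L u"
    and P: "0 < P" "P < V" and Q: "0 < Q" "Q < V"
  shows "a (sqrt (P * Q)) + b (sqrt (P * Q)) \<le> a P + b Q"
proof (rule ccontr)
  let ?n = "DIM('a)"
  define R where "R = sqrt (P * Q)"
  assume "\<not> ?thesis"
  then have less: "a P + b Q < a R + b R"
    by (simp add: R_def)
  have R: "0 < R" "R < V"
  proof -
    have "P * Q < V\<^sup>2"
      unfolding power2_eq_square using P Q by (intro mult_strict_mono) auto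
    then have "R < V"
      unfolding R_def using P by (intro real_less_lsqrt) auto
    then show "0 < R" "R < V"
      using P Q by (auto simp: R_def)
  qed
  have cM: "compact (K + L)" "convex (K + L)"
    using K L by (auto simp: compact_set_plus convex_set_plus)
  have VM: "measure lebesgue (K + L) = 2 ^ ?n * V"
    using measure_sum_ge_sqrt[OF K(1) L(1)] eq V P by simp
  have cR: "cut_vol K u (a R) = R" "cut_vol L u (b R) = R"
    using a b R V by (simp_all add: quantile_of_def)
  have "cut_vol (K + L) u (a R + b R) \<le> 2 ^ ?n * R"
  proof -
    have "2 ^ ?n * (V - R) = 2 ^ ?n * sqrt (measure lebesgue (K \<inter> {x. u \<bullet> x \<ge> a R})
        * measure lebesgue (L \<inter> {x. u \<bullet> x \<ge> b R}))"
      using measure_cut[OF K(1) u, of "a R"] measure_cut[OF L(1) u, of "b R"] V cR R by simp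
    also have "\<dots> \<le> measure lebesgue ((K \<inter> {x. u \<bullet> x \<ge> a R}) + (L \<inter> {x. u \<bullet> x \<ge> b R}))"
      by (intro measure_sum_ge_sqrt compact_Int_halfspace_ge K L)
    also have "\<dots> \<le> measure lebesgue ((K + L) \<inter> {x. u \<bullet> x \<ge> a R + b R})"
      by (intro measure_lebesgue_mono compact_set_plus compact_Int_halfspace_ge K L)
         (auto simp: set_plus_def inner_add_right intro: add_mono)
    finally show ?thesis
      using measure_cut[OF cM(1) u, of "a R + b R"] VM by (simp add: algebra_simps)
  qed
  moreover have "2 ^ ?n * R \<le> cut_vol (K + L) u (a P + b Q)"
    using cut_vol_sum_ge_sqrt[OF K(1) L(1), of u "a P" "b Q"] a b P Q V by (simp add: quantile_of_def R_def)
  moreover have "2 ^ ?n * R < 2 ^ ?n * V" "0 < 2 ^ ?n * R"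
    using R by auto
  ultimately show False
    using cut_vol_strict_mono[OF cM u less] VM by linarith
qed

text \<open>In the logarithmic variable \<open>x = ln p\<close> the geometric mean becomes the
  midpoint of \<open>x + h\<close> and \<open>x - h\<close>. Substituting \<open>-h\<close> for
  \<open>h\<close> exchanges the roles of \<open>a\<close> and \<open>b\<close>, so their increments
  bound each other and agree.\<close>

lemma quantile_diff_const:
  fixes K L :: "'a::euclidean_space set"
  assumes K: "compact K" "convex K" and L: "compact L" "convex L"
    and V: "measure lebesgue K = V" "measure lebesgue L = V" "0 < V"
    and eq: "measure lebesgue (K + L) \<le> 2 ^ DIM('a) * V" and u: "u \<noteq> 0"
    and a: "quantile_of a K u" and b: "quantile_of b L u"
  obtains d where "\<And>p. 0 < p \<Longrightarrow> p < V \<Longrightarrow> a p = b p + d"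
proof -
  define w where "w = ln V"
  have w: "exp x < V \<longleftrightarrow> x < w" for x
    using V(3) by (metis exp_less_cancel_iff exp_ln w_def)
  have sq: "sqrt (exp (x + h) * exp (x - h)) = exp x" for x h :: real
    by (simp add: exp_add[symmetric] real_sqrt_unique power2_eq_square)
  have ex: "a (exp x) + b (exp x) \<le> a (exp (x + h)) + b (exp (x - h))" if "x + h < w" "x - h < w" for x h
    using quantile_exchange[OF K L V(1,2) eq u a b, of "exp (x + h)" "exp (x - h)"] that by (simp add: w sq)
  have ex': "b (exp x) + a (exp x) \<le> b (exp (x + h)) + a (exp (x - h))" if "x + h < w" "x - h < w" for x h
    using ex[of x "-h"] that by simp
  have ma: "a (exp x) \<le> a (exp y)" and mb: "b (exp x) \<le> b (exp y)" if "x \<le> y" "y < w" for x y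
    using quantile_mono[OF K(1) a] quantile_mono[OF L(1) b] that V by (simp_all add: w)
  have la: "\<exists>z<y. a (exp y) - e \<le> a (exp z)" if yw: "y < w" and e: "0 < e" for y e
  proof -
    obtain q where "0 < q" "q < exp y" "a (exp y) - e \<le> a q"
      using quantile_left_cont[OF K u a, of "exp y" e] yw e V by (auto simp: w)
    then show ?thesis
      by (intro exI[of _ "ln q"]) (auto simp: ln_less_cancel_iff[of q "exp y", simplified])
  qed
  have lb: "\<exists>z<y. b (exp y) - e \<le> b (exp z)" if yw: "y < w" and e: "0 < e" for y e
  proof -
    obtain q where "0 < q" "q < exp y" "b (exp y) - e \<le> b q"
      using quantile_left_cont[OF L u b, of "exp y" e] yw e V by (auto simp: w)
    then show ?thesis
      by (intro exI[of _ "ln q"]) (auto simp: ln_less_cancel_iff[of q "exp y", simplified])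
  qed
  have const: "a (exp x) - b (exp x) = a (exp y) - b (exp y)" if "x < y" "y < w" for x y
    using increment_le_of_exchange[of w "\<lambda>x. a (exp x)" "\<lambda>x. b (exp x)", OF ex mb lb that]
      increment_le_of_exchange[of w "\<lambda>x. b (exp x)" "\<lambda>x. a (exp x)", OF ex' ma la that] by simp
  show ?thesis
  proof (rule that[of "a (V / 2) - b (V / 2)"])
    fix p assume p: "0 < p" "p < V"
    have e: "exp (ln p) = p" "exp (ln (V / 2)) = V / 2"
      using p V by auto
    have "ln p < w" "ln (V / 2) < w"
      using p V by (auto simp: w_def)
    then have "a (exp (ln p)) - b (exp (ln p)) = a (exp (ln (V / 2))) - b (exp (ln (V / 2)))"
      using const[of "ln p" "ln (V / 2)"] const[of "ln (V / 2)" "ln p"]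
      by (metis linorder_less_linear)
    then show "a p = b p + (a (V / 2) - b (V / 2))"
      unfolding e by simp
  qed
qed


text \<open>Otherwise some \<open>q\<close> lies strictly between the two cut volumes, and the
  quantiles at \<open>q\<close> violate the bound on \<open>a q\<close>.\<close>

lemma cut_vol_shift_le:
  assumes "compact K" "compact L" and V: "measure lebesgue K = V" "measure lebesgue L = V"
    and a: "quantile_of a K u" and b: "quantile_of b L u"
    and d: "\<And>p. 0 < p \<Longrightarrow> p < V \<Longrightarrow> a p \<le> b p + d"
  shows "cut_vol L u t \<le> cut_vol K u (t + d)"
proof (rule ccontr)
  assume "\<not> ?thesis"
  then obtain q where q: "cut_vol K u (t + d) < q" "q < cut_vol L u t"
    using dense not_le by blast
  have q0: "0 < q" "q < V"
    using q cut_vol_le[OF assms(2), of u t] V measure_nonneg[of lebesgue "K \<inter> {x. u \<bullet> x \<le> t + d}"] by linarith+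
  have cq: "cut_vol K u (a q) = q" "cut_vol L u (b q) = q"
    using a b q0 V by (simp_all add: quantile_of_def)
  have "b q < t"
    using cut_vol_mono[OF assms(2), of t "b q" u] q cq by linarith
  then have "a q \<le> t + d"
    using d[OF q0] by simp
  then have "q \<le> cut_vol K u (t + d)"
    using cut_vol_mono[OF assms(1), of "a q" "t + d" u] cq by simp
  then show False
    using q by simp
qed

lemma cut_vol_shift:
  fixes K L :: "'a::euclidean_space set"
  assumes K: "compact K" "convex K" and L: "compact L" "convex L"
    and V: "measure lebesgue K = V" "measure lebesgue L = V" "0 < V"
    and eq: "measure lebesgue (K + L) \<le> 2 ^ DIM('a) * V" and u: "u \<noteq> 0"
  obtains d where "\<And>t. cut_vol L u t = cut_vol K u (t + d)"
proof -
  obtain a b where ab: "quantile_of a K u" "quantile_of b L u"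
    using exists_quantile[OF K(1) u] exists_quantile[OF L(1) u] by metis
  obtain d where d: "\<And>p. 0 < p \<Longrightarrow> p < V \<Longrightarrow> a p = b p + d"
    using quantile_diff_const[OF K L V eq u ab] by blast
  show ?thesis
  proof (rule that[of d], rule antisym)
    fix t
    show "cut_vol L u t \<le> cut_vol K u (t + d)"
      using d by (intro cut_vol_shift_le[OF K(1) L(1) V(1,2) ab]) simp
    show "cut_vol K u (t + d) \<le> cut_vol L u t"
      using cut_vol_shift_le[OF L(1) K(1) V(2,1) ab(2,1), of "- d" "t + d"] d by simp
  qed
qed

section \<open>First moments and the translation vector\<close>

definition moment :: "'a::euclidean_space set \<Rightarrow> 'a" where
  "moment A = integral\<^sup>L (restrict_space lebesgue A) (\<lambda>x. x)"

text \<open>For positive volume, \<open>moment A\<close> is the centroid times the volume. Reading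
  its components off the marginals is what later combines the shifts in the separate directions into
  a single vector.\<close>

lemma inner_moment:
  assumes "compact A"
  shows "u \<bullet> moment A = integral\<^sup>L (marginal A u) (\<lambda>y. y)"
    and "integrable (marginal A u) (\<lambda>y. y)"
proof -
  interpret finite_measure "restrict_space lebesgue A"
    using lmeasurable_compact[OF assms]
    by (intro finite_measureI)
       (auto simp: fmeasurable_def emeasure_restrict_space space_restrict_space)
  obtain c where "\<And>x. x \<in> A \<Longrightarrow> norm x \<le> c"
    using compact_imp_bounded[OF assms] by (auto simp: bounded_iff)
  then have int: "integrable (restrict_space lebesgue A) (\<lambda>x. x)"
    by (intro integrable_const_bound[where B=c] AE_I2 measurable_restrict_space1 measurable_completion)
       (simp_all add: space_restrict_space)
  have "integral\<^sup>L (marginal A u) (\<lambda>y. y) = integral\<^sup>L (restrict_space lebesgue A) (\<lambda>x. u \<bullet> x)"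
    unfolding marginal_def by (rule integral_distr) auto
  also have "\<dots> = u \<bullet> moment A"
    unfolding moment_def by (rule integral_inner_right) (rule int)
  finally show "u \<bullet> moment A = integral\<^sup>L (marginal A u) (\<lambda>y. y)" ..
  show "integrable (marginal A u) (\<lambda>y. y)"
    unfolding marginal_def
    by (subst integrable_distr_eq[OF measurable_inner_restrict]) (auto intro!: integrable_inner_right int)
qed

text \<open>Finite measures on the line are determined by their distribution functions, here the cut
  volumes.\<close>

lemma marginal_shift:
  assumes K: "compact K" and L: "compact L" and sh: "\<And>t. cut_vol L u t = cut_vol K u (t + d)"
  shows "marginal L u = distr (marginal K u) borel (\<lambda>y. y - d)"
proof (rule cdf_unique')
  interpret K: finite_borel_measure "marginal K u"
    by (rule finite_borel_measure_marginal[OF K])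
  have meas: "(\<lambda>y. y - d) \<in> measurable (marginal K u) borel"
    by (simp add: marginal_def)
  interpret D: finite_measure "distr (marginal K u) borel (\<lambda>y. y - d)"
    using meas by (rule K.finite_measure_distr)
  show "finite_borel_measure (distr (marginal K u) borel (\<lambda>y. y - d))"
    by unfold_locales simp
  show "finite_borel_measure (marginal L u)"
    by (rule finite_borel_measure_marginal[OF L])
  show "cdf (marginal L u) = cdf (distr (marginal K u) borel (\<lambda>y. y - d))"
  proof
    fix t
    have "cdf (distr (marginal K u) borel (\<lambda>y. y - d)) t
        = measure (marginal K u) ((\<lambda>y. y - d) -` {..t} \<inter> space (marginal K u))"
      unfolding cdf_def using meas by (intro measure_distr) auto
    also have "(\<lambda>y. y - d) -` {..t} \<inter> space (marginal K u) = {..t + d}"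
      by (auto simp: marginal_def)
    also have "measure (marginal K u) {..t + d} = cdf (marginal L u) t"
      using sh[of t] unfolding cdf_marginal[OF L] cdf_def2[of "marginal K u", symmetric] cdf_marginal[OF K] by simp
    finally show "cdf (marginal L u) t = cdf (distr (marginal K u) borel (\<lambda>y. y - d)) t" ..
  qed
qed

lemma moment_shift:
  assumes K: "compact K" and L: "compact L" and sh: "\<And>t. cut_vol L u t = cut_vol K u (t + d)"
  shows "u \<bullet> moment L = u \<bullet> moment K - d * measure lebesgue K"
proof -
  interpret K: finite_borel_measure "marginal K u"
    by (rule finite_borel_measure_marginal[OF K])
  have "u \<bullet> moment L = integral\<^sup>L (marginal K u) (\<lambda>y. y - d)"
    unfolding inner_moment(1)[OF L] marginal_shift[OF assms]
    by (subst integral_distr) (auto simp: marginal_def)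
  also have "\<dots> = u \<bullet> moment K - d * measure (marginal K u) (space (marginal K u))"
    using inner_moment[OF K, of u] by simp
  also have "measure (marginal K u) (space (marginal K u)) = measure lebesgue K"
    using measure_marginal[OF K, of UNIV u] by (simp add: marginal_def)
  finally show ?thesis .
qed

text \<open>A hyperplane separating \<open>x + z\<close> from \<open>K\<close> would leave no volume
  of \<open>K\<close> on its lower side, whereas the copy of \<open>L\<close> shifted by
  \<open>z\<close> has positive volume there, since \<open>x + z\<close> lies on that side.\<close>

lemma translate_subset_of_cut_vol:
  fixes K L :: "'a::euclidean_space set"
  assumes K: "compact K" "convex K" "K \<noteq> {}" and L: "compact L" "convex L" "0 < measure lebesgue L"
    and cut: "\<And>u t. u \<noteq> 0 \<Longrightarrow> cut_vol L u t = cut_vol K u (t + u \<bullet> z)"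
    and "x \<in> L"
  shows "x + z \<in> K"
proof (rule ccontr)
  assume "x + z \<notin> K"
  then obtain u c where u: "u \<bullet> (x + z) < c" "\<forall>y\<in>K. c < u \<bullet> y"
    using separating_hyperplane_closed_point[OF K(2) compact_imp_closed[OF K(1)]] by blast
  then have "u \<noteq> 0"
    using K(3) by fastforce
  have "K \<inter> {y. u \<bullet> y \<le> c} = {}"
    using u(2) by fastforce
  then have "cut_vol L u (c - u \<bullet> z) = 0"
    using cut[OF \<open>u \<noteq> 0\<close>, of "c - u \<bullet> z"] by simp
  moreover have "0 < cut_vol L u (c - u \<bullet> z)"
    using u(1) \<open>x \<in> L\<close> by (intro cut_vol_pos[OF L, of x]) (auto simp: inner_add_right)
  ultimately show False
    by simp
qed

lemma translate_of_measure_sum_eq: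
  fixes K L :: "'a::euclidean_space set"
  assumes K: "compact K" "convex K" and L: "compact L" "convex L"
    and V: "measure lebesgue K = V" "measure lebesgue L = V" "0 < V"
    and eq: "measure lebesgue (K + L) \<le> 2 ^ DIM('a) * V"
  shows "translate_of K L"
proof -
  \<comment> \<open>The difference of the centroids. Comparing first moments forces the shift in
    direction \<open>u\<close> to be \<open>u \<bullet> z\<close>, so it is linear in
    \<open>u\<close>.\<close>
  define z where "z = (1 / V) *\<^sub>R (moment K - moment L)"
  have cut: "cut_vol L u t = cut_vol K u (t + u \<bullet> z)" if u: "u \<noteq> 0" for u t
  proof -
    obtain d where d: "\<And>t. cut_vol L u t = cut_vol K u (t + d)"
      using cut_vol_shift[OF K L V eq u] by blast
    have "u \<bullet> moment K - u \<bullet> moment L = V * d"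
      using moment_shift[OF K(1) L(1) d] V(1) by simp
    then have "u \<bullet> z = d"
      using V(3) by (simp add: z_def inner_diff_right)
    then show ?thesis
      using d by simp
  qed
  have ne: "K \<noteq> {}" "L \<noteq> {}"
    using V by auto
  have "x + z \<in> K" if "x \<in> L" for x
    using translate_subset_of_cut_vol[OF K ne(1) L] cut that V by simp
  moreover have "x + - z \<in> L" if "x \<in> K" for x
    using that cut V by (intro translate_subset_of_cut_vol[OF L ne(2) K]) auto
  ultimately have "K = (\<lambda>x. z + x) ` L"
    by (force simp: image_iff add.commute)
  then show ?thesis
    unfolding translate_of_def by blast
qed

text \<open>The equality case of AM-GM: the terms \<open>x i / G - 1 - ln (x i / G)\<close> are
  nonnegative with sum at most 0, so all of them vanish, which happens only at
  \<open>x i = G\<close>.\<close>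

lemma eq_of_sum_le_geometric_mean:
  fixes x :: "'i \<Rightarrow> real"
  assumes S: "finite S" "S \<noteq> {}" and x: "\<And>i. i \<in> S \<Longrightarrow> 0 < x i"
    and le: "sum x S \<le> card S * root (card S) (prod x S)" and "i \<in> S"
  shows "x i = root (card S) (prod x S)"
proof -
  define G where "G = root (card S) (prod x S)"
  have c: "0 < card S"
    using S by (simp add: card_gt_0_iff)
  have G: "0 < G"
    unfolding G_def using c x by (simp add: prod_pos)
  have Gc: "G ^ card S = prod x S"
    unfolding G_def using c x by (intro real_root_pow_pos prod_pos)
  have "(\<Sum>i\<in>S. ln (x i / G)) = ln (\<Prod>i\<in>S. x i / G)"
    using S x G by (subst ln_prod) (auto simp: less_imp_neq[symmetric])
  also have "(\<Prod>i\<in>S. x i / G) = 1"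
    using G by (simp add: prod_dividef flip: Gc)
  finally have "(\<Sum>i\<in>S. x i / G - 1 - ln (x i / G)) = sum x S / G - card S"
    by (simp add: sum_subtractf sum_divide_distrib)
  also have "\<dots> \<le> 0"
    using le G by (simp add: G_def[symmetric] field_simps)
  finally have "(\<Sum>i\<in>S. x i / G - 1 - ln (x i / G)) \<le> 0" .
  moreover have nn: "0 \<le> x i / G - 1 - ln (x i / G)" if "i \<in> S" for i
    using ln_le_minus_one[of "x i / G"] x[OF that] G by simp
  ultimately have "(\<Sum>i\<in>S. x i / G - 1 - ln (x i / G)) = 0"
    by (intro antisym sum_nonneg)
  then have "x i / G - 1 - ln (x i / G) = 0"
    using sum_nonneg_eq_0_iff[OF S(1), of "\<lambda>i. x i / G - 1 - ln (x i / G)"] nn \<open>i \<in> S\<close> by blast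
  then have "x i / G = 1"
    using x[OF \<open>i \<in> S\<close>] G by (intro ln_eq_minus_one) auto
  then show ?thesis
    using G by (simp add: G_def)
qed

subsection \<open>The main result\<close>

lemma measure_minkowski_mean:
  fixes A :: "nat \<Rightarrow> 'a::euclidean_space set"
  shows "measure lebesgue (minkowski_mean m A) = measure lebesgue (\<Sum>i<m. A i) / real m ^ DIM('a)"
  using measure_lebesgue_affine[of "1 / real m" 0 "\<Sum>i<m. A i"]
  by (simp add: minkowski_mean_def power_one_over)

lemma prod_measure_powr:
  fixes K :: "nat \<Rightarrow> 'a::euclidean_space set"
  assumes "0 < m"
  shows "(\<Prod>i<m. measure lebesgue (K i) powr (1 / real m)) = root m (\<Prod>i<m. vrad (K i)) ^ DIM('a)"
proof -
  have "(\<Prod>i<m. measure lebesgue (K i) powr (1 / real m)) = (\<Prod>i<m. measure lebesgue (K i)) powr (1 / real m)"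
    by (simp add: prod_powr_distrib)
  also have "\<dots> = root m (\<Prod>i<m. measure lebesgue (K i))"
    using assms by (simp add: root_powr_inverse prod_nonneg)
  also have "(\<Prod>i<m. measure lebesgue (K i)) = (\<Prod>i<m. vrad (K i)) ^ DIM('a)"
    by (simp add: vrad_pow prod_power_distrib)
  finally show ?thesis
    using assms by (simp add: real_root_power)
qed

text \<open>One alternative of the dichotomy is the claim in strict form; in the other, AM-GM and
  Brunn-Minkowski bound the volume of the full sum from below.\<close>

lemma measure_sum_frontiers_ge:
  fixes K :: "'i \<Rightarrow> 'a::euclidean_space set"
  assumes n: "2 \<le> DIM('a)" and I: "finite I" "3 \<le> card I"
    and K: "\<And>i. i \<in> I \<Longrightarrow> compact (K i)" "\<And>i. i \<in> I \<Longrightarrow> connected (frontier (K i))"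
      "\<And>i. i \<in> I \<Longrightarrow> 0 < measure lebesgue (K i)"
  shows "(card I * root (card I) (\<Prod>i\<in>I. vrad (K i))) ^ DIM('a) \<le> measure lebesgue (\<Sum>i\<in>I. frontier (K i))"
proof -
  have "I \<noteq> {}"
    using I by auto
  then have "card I * root (card I) (\<Prod>i\<in>I. vrad (K i)) \<le> (\<Sum>i\<in>I. vrad (K i))"
    using root_prod_le_mean[OF I(1), of "\<lambda>i. vrad (K i)"] I K(3) by (auto simp: field_simps)
  also have "\<dots> \<le> vrad (\<Sum>i\<in>I. K i)"
    using K by (intro brunn_minkowski_sum I) fastforce+
  finally have "(card I * root (card I) (\<Prod>i\<in>I. vrad (K i))) ^ DIM('a) \<le> vrad (\<Sum>i\<in>I. K i) ^ DIM('a)"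
    by (intro power_mono mult_nonneg_nonneg real_root_ge_zero prod_nonneg) auto
  then show ?thesis
    using sum_frontiers_dichotomy[where K=K, OF n I K] unfolding vrad_pow by linarith
qed

text \<open>Equality excludes the strict alternative, so the full sum has volume radius at most
  \<open>card I * G\<close>. The equality case of AM-GM then makes all radii equal to
  \<open>G\<close>, and every pair attains equality in Brunn-Minkowski.\<close>

lemma translates_of_measure_sum_frontiers_eq:
  fixes K :: "'i \<Rightarrow> 'a::euclidean_space set"
  assumes n: "2 \<le> DIM('a)" and I: "finite I" "3 \<le> card I"
    and K: "\<And>i. i \<in> I \<Longrightarrow> convex_body (K i)" "\<And>i. i \<in> I \<Longrightarrow> connected (frontier (K i))"
    and eq: "measure lebesgue (\<Sum>i\<in>I. frontier (K i)) = (card I * root (card I) (\<Prod>i\<in>I. vrad (K i))) ^ DIM('a)"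
    and ij: "i \<in> I" "j \<in> I"
  shows "translate_of (K i) (K j)"
proof (cases "i = j")
  case True
  then show ?thesis
    unfolding translate_of_def by (intro exI[of _ 0]) simp
next
  case False
  let ?v = "measure lebesgue :: 'a set \<Rightarrow> real" and ?n = "DIM('a)"
  define G where "G = root (card I) (\<Prod>i\<in>I. vrad (K i))"
  have C: "compact (K l)" "convex (K l)" if "l \<in> I" for l
    using K(1)[OF that] by (auto simp: convex_body_def)
  have pos: "0 < ?v (K l)" if "l \<in> I" for l
  proof -
    have "\<not> negligible (K l)"
      using K(1)[OF that] open_not_negligible[of "interior (K l)"] negligible_subset[OF _ interior_subset, of "K l"]
      by (auto simp: convex_body_def)
    then show ?thesis
      using C[OF that] by (simp add: negligible_iff_measure lmeasurable_compact zero_less_measure_iff)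
  qed
  have ne: "K l \<noteq> {}" if "l \<in> I" for l
    using pos[OF that] by auto
  have G0: "0 \<le> card I * G"
    unfolding G_def by (intro mult_nonneg_nonneg real_root_ge_zero prod_nonneg) auto
  have "vrad (\<Sum>i\<in>I. K i) ^ ?n \<le> (card I * G) ^ ?n"
    using sum_frontiers_dichotomy[where K=K, OF n I C(1) K(2) pos] eq unfolding G_def vrad_pow by linarith
  then have up: "vrad (\<Sum>i\<in>I. K i) \<le> card I * G"
    using G0 by (subst (asm) power_mono_iff) auto
  have low: "(\<Sum>l\<in>I. vrad (K l)) \<le> vrad (\<Sum>i\<in>I. K i)"
    using C ne by (intro brunn_minkowski_sum I) auto
  have rG: "vrad (K l) = G" if "l \<in> I" for l
    unfolding G_def using I pos up low that by (intro eq_of_sum_le_geometric_mean) (auto simp: G_def)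
  define J where "J = I - {i, j}"
  have IJ: "I = insert i (insert j J)" "i \<notin> insert j J" "j \<notin> J" "finite J"
    using ij False I by (auto simp: J_def)
  have cij: "compact (K i + K j)" "K i + K j \<noteq> {}"
    using compact_set_plus[OF C(1)[OF ij(1)] C(1)[OF ij(2)]] ij ne by simp_all
  \<comment> \<open>The remaining sets contribute at least their radii to the full sum, so
    subtracting these leaves at most \<open>2 * G\<close> for the pair.\<close>
  have "vrad (K i + K j) + (\<Sum>l\<in>J. vrad (K l)) \<le> vrad (K i + K j) + vrad (\<Sum>l\<in>J. K l)"
    using C ne IJ by (intro add_left_mono brunn_minkowski_sum) auto
  also have "\<dots> \<le> vrad ((K i + K j) + (\<Sum>l\<in>J. K l))"
    using C ne IJ cij by (intro brunn_minkowski_compact compact_sum_sets sum_sets_nonempty) auto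
  also have "(K i + K j) + (\<Sum>l\<in>J. K l) = (\<Sum>l\<in>I. K l)"
    using IJ by (simp add: add.assoc)
  also have "vrad \<dots> \<le> (\<Sum>l\<in>I. vrad (K l))"
    using up rG by simp
  also have "\<dots> = 2 * G + (\<Sum>l\<in>J. vrad (K l))"
    using IJ rG by (simp add: algebra_simps)
  finally have "vrad (K i + K j) \<le> 2 * G"
    by simp
  then have "vrad (K i + K j) ^ ?n \<le> (2 * G) ^ ?n"
    by (intro power_mono) auto
  then have "?v (K i + K j) \<le> 2 ^ ?n * G ^ ?n"
    by (simp add: vrad_pow power_mult_distrib)
  moreover have "?v (K i) = G ^ ?n" "?v (K j) = G ^ ?n"
    using rG ij by (simp_all flip: vrad_pow)
  ultimately show ?thesis
    using C ij pos[OF ij(1)] by (intro translate_of_measure_sum_eq[where V = "G ^ ?n"]) auto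
qed

lemma sum_translates_subset:
  fixes C :: "'a::real_vector set"
  assumes "finite I" "I \<noteq> {}" "convex C" "\<And>i. i \<in> I \<Longrightarrow> K i = (\<lambda>x. v i + x) ` C"
  shows "(\<Sum>i\<in>I. K i) \<subseteq> (\<lambda>x. real (card I) *\<^sub>R x + sum v I) ` C"
proof
  fix x assume "x \<in> (\<Sum>i\<in>I. K i)"
  then obtain s where s: "x = sum s I" "\<forall>i\<in>I. s i \<in> K i"
    unfolding set_sum_alt[OF assms(1)] by auto
  have c: "0 < card I"
    using assms(1,2) by (simp add: card_gt_0_iff)
  \<comment> \<open>The average of the representatives of the summands in \<open>C\<close>, which
    convexity keeps in \<open>C\<close>.\<close>
  define y where "y = (\<Sum>i\<in>I. (1 / real (card I)) *\<^sub>R (s i - v i))"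
  have "y \<in> C"
    unfolding y_def
  proof (rule convex_sum[OF assms(1,3)])
    show "s i - v i \<in> C" if "i \<in> I" for i
      using bspec[OF s(2) that] unfolding assms(4)[OF that] by auto
  qed (use c in auto)
  moreover have "x = real (card I) *\<^sub>R y + sum v I"
    using c by (simp add: y_def s(1) sum_subtractf flip: scaleR_sum_right)
  ultimately show "x \<in> (\<lambda>x. real (card I) *\<^sub>R x + sum v I) ` C"
    by blast
qed

lemma sum_sets_mono: "(\<And>i. i \<in> I \<Longrightarrow> A i \<subseteq> B i) \<Longrightarrow> (\<Sum>i\<in>I. A i) \<subseteq> (\<Sum>i\<in>I. B i)"
  for A B :: "'i \<Rightarrow> 'a::comm_monoid_add set"
  by (induction I rule: infinite_finite_induct) (simp_all add: set_plus_mono2)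

text \<open>By convexity all sums of points from the translates lie in a dilated and shifted copy of
  \<open>K i\<close>, with dilation factor \<open>card I\<close>.\<close>

lemma measure_sum_frontiers_translates_le:
  fixes K :: "'i \<Rightarrow> 'a::euclidean_space set"
  assumes I: "finite I" and i: "i \<in> I" and K: "\<And>j. j \<in> I \<Longrightarrow> compact (K j)" "convex (K i)"
    and tr: "\<And>j. j \<in> I \<Longrightarrow> translate_of (K j) (K i)"
  shows "measure lebesgue (\<Sum>j\<in>I. frontier (K j)) \<le> real (card I) ^ DIM('a) * measure lebesgue (K i)"
proof -
  obtain v where v: "\<And>j. j \<in> I \<Longrightarrow> K j = (\<lambda>x. v j + x) ` K i"
    using tr unfolding translate_of_def by metis
  let ?T = "(\<lambda>x. real (card I) *\<^sub>R x + sum v I) ` K i"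
  have "frontier (K j) \<subseteq> K j" if "j \<in> I" for j
    using K(1)[OF that] by (simp add: compact_imp_closed frontier_subset_closed)
  then have "(\<Sum>j\<in>I. frontier (K j)) \<subseteq> (\<Sum>j\<in>I. K j)"
    by (rule sum_sets_mono)
  also have "\<dots> \<subseteq> ?T"
    using i by (intro sum_translates_subset[OF I _ K(2) v]) auto
  finally have "measure lebesgue (\<Sum>j\<in>I. frontier (K j)) \<le> measure lebesgue ?T"
  proof (rule measure_lebesgue_mono)
    show "compact (\<Sum>j\<in>I. frontier (K j))"
      using K(1) by (auto intro: compact_sum_sets)
    show "compact ?T"
      using compact_affinity[OF K(1)[OF i], of "sum v I" "real (card I)"] by (simp add: add.commute)
  qed
  also have "\<dots> = real (card I) ^ DIM('a) * measure lebesgue (K i)"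
    using measure_lebesgue_affine[of "real (card I)" "sum v I" "K i"] by simp
  finally show ?thesis .
qed

theorem corollary1p2:
  fixes K :: "nat \<Rightarrow> (real ^ 'n) set" and m :: nat
  assumes "CARD('n) \<ge> 2"
    and "m > 2"
    and "\<And>i. i < m \<Longrightarrow> compact (K i)"
    and "\<And>i. i < m \<Longrightarrow> connected (frontier (K i))"
  shows "measure lebesgue (minkowski_mean m (\<lambda>i. frontier (K i)))
           \<ge> (\<Prod>i<m. measure lebesgue (K i) powr (1 / real m))
       \<and> ((\<forall>i<m. convex_body (K i)) \<longrightarrow>
           (measure lebesgue (minkowski_mean m (\<lambda>i. frontier (K i)))
              = (\<Prod>i<m. measure lebesgue (K i) powr (1 / real m))
            \<longleftrightarrow> (\<forall>i<m. \<forall>j<m. translate_of (K i) (K j))))"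
proof -
  let ?n = "CARD('n)"
  let ?mean = "measure lebesgue (minkowski_mean m (\<lambda>i. frontier (K i)))"
  let ?prod = "\<Prod>i<m. measure lebesgue (K i) powr (1 / real m)"
  let ?S = "measure lebesgue (\<Sum>i<m. frontier (K i))"
  define G where "G = root m (\<Prod>i<m. vrad (K i))"
  have m: "0 < real m ^ ?n"
    using assms(2) by simp
  have mean: "?mean = ?S / real m ^ ?n"
    by (simp add: measure_minkowski_mean)
  have prod: "?prod = (real m * G) ^ ?n / real m ^ ?n"
    using prod_measure_powr[of m K] assms(2) by (simp add: G_def power_mult_distrib)
  have dim: "2 \<le> DIM(real ^ 'n)" and card: "3 \<le> card {..<m}"
    using assms by auto
  have lower: "?prod \<le> ?mean"
  proof (cases "\<forall>i<m. 0 < measure lebesgue (K i)")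
    case True
    then have "(real m * G) ^ ?n \<le> ?S"
      using measure_sum_frontiers_ge[OF dim _ card, of K] assms(3,4) by (simp add: G_def)
    then show ?thesis
      unfolding mean prod using m by (simp add: divide_right_mono)
  next
    case False
    then obtain i where "i < m" "measure lebesgue (K i) = 0"
      using zero_less_measure_iff by blast
    \<comment> \<open>The factor at \<open>i\<close> is \<open>0 powr (1 / real m)\<close>, which is
      0.\<close>
    then have "?prod = 0"
      by (intro prod_zero) auto
    then show ?thesis
      by (simp only: measure_nonneg)
  qed
  moreover have "?mean = ?prod \<longleftrightarrow> (\<forall>i<m. \<forall>j<m. translate_of (K i) (K j))"
    if body: "\<forall>i<m. convex_body (K i)"
  proof
    assume "?mean = ?prod"
    then have "?S = (real m * G) ^ ?n"
      unfolding mean prod using m by simp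
    then show "\<forall>i<m. \<forall>j<m. translate_of (K i) (K j)"
      using translates_of_measure_sum_frontiers_eq[OF dim _ card, of K] assms(4) body by (simp add: G_def)
  next
    assume tr: "\<forall>i<m. \<forall>j<m. translate_of (K i) (K j)"
    have "measure lebesgue (K i) = measure lebesgue (K 0)" if "i < m" for i
    proof -
      have "translate_of (K i) (K 0)"
        using tr that assms(2) by simp
      then show ?thesis
        by (auto simp: translate_of_def measure_translation)
    qed
    then have "?prod = (\<Prod>i<m. measure lebesgue (K 0) powr (1 / real m))"
      by (intro prod.cong refl) (metis lessThan_iff)
    also have "\<dots> = measure lebesgue (K 0)"
      using assms(2) by (simp flip: root_powr_inverse)
    finally have "?prod = measure lebesgue (K 0)" .
    moreover have "?S \<le> real m ^ ?n * measure lebesgue (K 0)"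
      using measure_sum_frontiers_translates_le[of "{..<m}" 0 K] assms(2,3) tr body
      by (simp add: convex_body_def)
    then have "?mean \<le> measure lebesgue (K 0)"
      unfolding mean using m by (simp add: pos_divide_le_eq mult.commute)
    ultimately show "?mean = ?prod"
      using lower by simp
  qed
  ultimately show ?thesis
    by blast
qed

end
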